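(* Let $V=V_0\oplus V_1$ be a finite-dimensional complex super vector space with a nondegenerate supersymmetric even bilinear form $b$, with adapted coordinates $e_1,\dots,e_k$ of $V_0$ and $\xi_1,\dots,\xi_{2\ell}$ of $V_1$. Let $\widehat{C}=\sum_{i=1}^{k}e_i\otimes e_i-\sum_{i=1}^{2\ell}\xi_i\otimes\eta_i\in V\otimes V$ be the twisted element, and let $h=(h_d)_{d\ge0}$ be a family of linear functionals $h_d$ on the super symmetric powers $\operatorname{Sym}_s^{d}V$ vanishing in odd exterior degree. Then for every graph $G$ without free circles, $$\mathrm{TN}_{h,\widehat{C}}(G)=p_h(G).$$
   Context: Graphs. A graph is a finite multigraph with loops and parallel edges permitted; each edge consists of two half-edges, one at each endpoint, and the two half-edges of a loop are distinct and lie at the same vertex. $\deg(v)$ counts half-edges at $v$. (In general graphs may also have free circles, closed edges incident with no vertex; only graphs without them occur here.) $[n]=\{1,\dots,n\}$. Coordinates. $b$ even means $b(V_0,V_1)=b(V_1,V_0)=0$; supersymmetric means $b(x,y)=(-1)^{|x||y|}b(y,x)$ for homogeneous $x,y$. Then $\dim V_1=2\ell$ is even. Adapted coordinates: $b(e_i,e_j)=\delta_{ij}$; $b(\xi_m,\xi_{m+\ell})=1=-b(\xi_{m+\ell},\xi_m)$ for $m\le\ell$, and $b(\xi_i,\xi_j)=0$ otherwise. Put $\eta_i=-\xi_{i+\ell}$ for $i\le\ell$ and $\eta_i=\xi_{i-\ell}$ for $i>\ell$. Super symmetric powers. $S_d$ acts on $V^{\otimes d}$ by permuting tensor factors with Koszul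 signs (the sign of the induced permutation of the odd letters). $\varpi_d\colon V^{\otimes d}\to\operatorname{Sym}_s^{d}V$ is the quotient onto the coinvariants; $\operatorname{Sym}_sV=\bigoplus_d\operatorname{Sym}_s^dV\cong\operatorname{Sym}V_0\otimes\Lambda V_1$ canonically as graded algebras, under which $\varpi_d(e_{\mu_1}\otimes\dots\otimes e_{\mu_a}\otimes\xi_{i_1}\otimes\dots\otimes\xi_{i_j})=e_{\mu_1}\odot\dots\odot e_{\mu_a}\otimes\xi_{i_1}\wedge\dots\wedge\xi_{i_j}$ ($a+j=d$). The family $(h_d)$ is regarded as a single functional $h\in(\operatorname{Sym}V_0\otimes\Lambda V_1)^{*}$; vanishing in odd exterior degree means $h=0$ on $\operatorname{Sym}V_0\otimes\Lambda^{j}V_1$ for $j$ odd. Tensor network. For a graph $G$ without free circles with edge set $E$, and for an even $D\in V\otimes V$ fixed by the super symmetry $x\otimes y\mapsto(-1)^{|x||y|}y\otimes x$ (as $\widehat C$ is), $$\mathrm{TN}_{h,D}(G)=\Bigl(\bigotimes_{v\in V(G)}h_{\deg v}\circ\varpi_{\deg v}\Bigr)\Bigl(\mathrm{Regroup}_G\Bigl(\bigotimes_{e\in E}D\Bigr)\Bigr),$$ where orders of the edges, of the vertices and of the half-edges at each vertex are chosen, the two tensor legs of each factor $D$ are assigned to the two half-edges of its edge, and $\mathrm{Regroup}_G$ is the symmetry of super vector spaces (with Koszul signs) rearranging the word of legs in edge order into vertex–half-edge order. The value is independent of these choices. The sum $p_h$. For $F\subseteq E$, let $\delta_F(v)$ be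 the set of half-edges at $v$ belonging to edges of $F$. $F$ is Eulerian if $|\delta_F(v)|$ is even for all $v$. For Eulerian $F$ choose an orientation of the edges of $F$ with, at each vertex, equally many incoming as outgoing half-edges of $F$, and a local pairing $\kappa=(\kappa_v)_v$, pairing at each $v$ each incoming half-edge of $\delta_F(v)$ with an outgoing one; pairs are written $(a_1,a_2)$ with $a_1$ incoming. Following pairs from edge to edge decomposes $F$ into directed circuits, whose number is $c(\kappa)$. Then $$p_h(G)=\sum_{F\subseteq E\ \text{Eulerian}}(-1)^{c(\kappa)}\sum_{\psi\colon E\setminus F\to[k]}\ \sum_{\varphi\colon F\to[2\ell]}\ \prod_{v\in V(G)}h\Bigl(\bigodot_{a\in\delta_{E\setminus F}(v)}e_{\psi(a)}\otimes\bigwedge_{(a_1,a_2)\in\kappa_v}\xi_{\varphi(a_1)}\wedge\eta_{\varphi(a_2)}\Bigr),$$ each half-edge inheriting the colour of its edge (the value is independent of the chosen orientations and pairings). *)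

theory Defs
  imports Complex_Main "HOL-Library.Poly_Mapping" "HOL-Library.FuncSet"
    "HOL-Combinatorics.Permutations"
begin

section \<open>Complex vector spaces\<close>

class complex_vec = ab_group_add +
  fixes scaleC :: "complex \<Rightarrow> 'a \<Rightarrow> 'a" (infixr "*\<^sub>C" 75)
  assumes scaleC_add_right: "a *\<^sub>C (x + y) = a *\<^sub>C x + a *\<^sub>C y"
    and scaleC_add_left: "(a + b) *\<^sub>C x = a *\<^sub>C x + b *\<^sub>C x"
    and scaleC_scaleC: "a *\<^sub>C (b *\<^sub>C x) = (a * b) *\<^sub>C x"
    and scaleC_one: "1 *\<^sub>C x = x"

global_interpretation cvec: vector_space "scaleC :: complex \<Rightarrow> 'a \<Rightarrow> 'a::complex_vec"
  by unfold_locales (fact scaleC_add_right scaleC_add_left scaleC_scaleC scaleC_one)+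

abbreviation clinear :: "('a::complex_vec \<Rightarrow> 'b::complex_vec) \<Rightarrow> bool" where
  "clinear \<equiv> Vector_Spaces.linear scaleC scaleC"

lemma clinear_iff:
  "clinear f \<longleftrightarrow> (\<forall>x y. f (x + y) = f x + f y) \<and> (\<forall>c x. f (c *\<^sub>C x) = c *\<^sub>C f x)"
  by (auto simp: Vector_Spaces.linear_iff cvec.vector_space_axioms)

instantiation complex :: complex_vec
begin

definition scaleC_complex :: "complex \<Rightarrow> complex \<Rightarrow> complex" where
  "scaleC_complex = (*)"

instance
  by standard (simp_all add: scaleC_complex_def algebra_simps)

end

instantiation poly_mapping :: (type, complex_vec) complex_vec
begin

lift_definition scaleC_poly_mapping :: "complex \<Rightarrow> ('a \<Rightarrow>\<^sub>0 'b) \<Rightarrow> 'a \<Rightarrow>\<^sub>0 'b"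
  is "\<lambda>c f k. c *\<^sub>C f k"
  by (rule finite_subset) auto

instance
  by standard (transfer; simp add: fun_eq_iff scaleC_add_right scaleC_add_left scaleC_scaleC scaleC_one)+

end

lemma lookup_scaleC: "Poly_Mapping.lookup (c *\<^sub>C p) k = c *\<^sub>C Poly_Mapping.lookup p k"
  by transfer simp


section \<open>The tensor algebra\<close>

text \<open>
  The tensor algebra of a vector space is the free vector space on the words of vectors
  modulo multilinearity; its degree \<open>d\<close> part is the \<open>d\<close>-th tensor power.
\<close>

definition tensor_relations :: "('a::complex_vec list \<Rightarrow>\<^sub>0 complex) set" where
  "tensor_relations =
     {Poly_Mapping.single (u @ (x + y) # v) 1 - Poly_Mapping.single (u @ x # v) 1 - Poly_Mapping.single (u @ y # v) 1 | u x y v. True} \<union>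
     {Poly_Mapping.single (u @ (c *\<^sub>C x) # v) 1 - c *\<^sub>C Poly_Mapping.single (u @ x # v) 1 | u c x v. True}"

definition tensor_eq :: "('a::complex_vec list \<Rightarrow>\<^sub>0 complex) \<Rightarrow> ('a list \<Rightarrow>\<^sub>0 complex) \<Rightarrow> bool" where
  "tensor_eq s t \<longleftrightarrow> s - t \<in> cvec.span tensor_relations"

lemma equivp_diff_span: "equivp (\<lambda>s t. s - t \<in> cvec.span R)"
proof (rule equivpI)
  show "reflp (\<lambda>s t. s - t \<in> cvec.span R)"
    by (simp add: reflp_def cvec.span_zero)
  show "symp (\<lambda>s t. s - t \<in> cvec.span R)"
    using cvec.span_neg by (force simp: symp_def)
  show "transp (\<lambda>s t. s - t \<in> cvec.span R)"
    using cvec.span_add by (fastforce simp: transp_def)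
qed

lemma span_diff_minus: "s - t \<in> cvec.span R \<Longrightarrow> - s - - t \<in> cvec.span R"
  using cvec.span_neg[of "s - t" R] by (simp add: algebra_simps)

lemma span_diff_plus:
  "s - t \<in> cvec.span R \<Longrightarrow> s' - t' \<in> cvec.span R \<Longrightarrow> (s + s') - (t + t') \<in> cvec.span R"
  using cvec.span_add[of "s - t" R "s' - t'"] by (simp add: algebra_simps)

lemma span_diff_diff:
  "s - t \<in> cvec.span R \<Longrightarrow> s' - t' \<in> cvec.span R \<Longrightarrow> (s - s') - (t - t') \<in> cvec.span R"
  using cvec.span_diff[of "s - t" R "s' - t'"] by (simp add: algebra_simps)

lemma span_diff_scale: "s - t \<in> cvec.span R \<Longrightarrow> c *\<^sub>C s - c *\<^sub>C t \<in> cvec.span R"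
  using cvec.span_scale[of "s - t" R c] by (simp add: cvec.scale_right_diff_distrib)

quotient_type (overloaded) 'a tensor = "'a::complex_vec list \<Rightarrow>\<^sub>0 complex" / tensor_eq
  unfolding tensor_eq_def by (rule equivp_diff_span)

instantiation tensor :: (complex_vec) complex_vec
begin

lift_definition zero_tensor :: "'a tensor" is 0 .

lift_definition plus_tensor :: "'a tensor \<Rightarrow> 'a tensor \<Rightarrow> 'a tensor" is "(+)"
  unfolding tensor_eq_def by (rule span_diff_plus)

lift_definition minus_tensor :: "'a tensor \<Rightarrow> 'a tensor \<Rightarrow> 'a tensor" is "(-)"
  unfolding tensor_eq_def by (rule span_diff_diff)

lift_definition uminus_tensor :: "'a tensor \<Rightarrow> 'a tensor" is uminus
  unfolding tensor_eq_def by (rule span_diff_minus)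

lift_definition scaleC_tensor :: "complex \<Rightarrow> 'a tensor \<Rightarrow> 'a tensor" is scaleC
  unfolding tensor_eq_def by (rule span_diff_scale)

instance
  by standard (transfer; simp add: tensor_eq_def cvec.span_zero algebra_simps
      scaleC_add_right scaleC_add_left)+

end

text \<open>The elementary tensor \<open>x\<^sub>1 \<otimes> \<dots> \<otimes> x\<^sub>d\<close>.\<close>

lift_definition tensor_word :: "'a::complex_vec list \<Rightarrow> 'a tensor" is "\<lambda>w. Poly_Mapping.single w 1" .

definition tensor_power :: "nat \<Rightarrow> 'a::complex_vec tensor set" where
  "tensor_power d = cvec.span (tensor_word ` {w. length w = d})"

definition multilinear :: "('a::complex_vec list \<Rightarrow> 'b::complex_vec) \<Rightarrow> bool" where
  "multilinear f \<longleftrightarrow> (\<forall>u v. clinear (\<lambda>x. f (u @ x # v)))"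

text \<open>The linear map on the tensor algebra induced by a multilinear map on words.\<close>

definition tensor_lift :: "('a::complex_vec list \<Rightarrow> 'b::complex_vec) \<Rightarrow> 'a tensor \<Rightarrow> 'b" where
  "tensor_lift f = (THE F. clinear F \<and> (\<forall>w. F (tensor_word w) = f w))"

definition free_lift :: "('b \<Rightarrow> 'a::complex_vec) \<Rightarrow> ('b \<Rightarrow>\<^sub>0 complex) \<Rightarrow> 'a" where
  "free_lift f p = (\<Sum>w\<in>Poly_Mapping.keys p. Poly_Mapping.lookup p w *\<^sub>C f w)"

lemma free_lift_superset:
  assumes "finite A" "Poly_Mapping.keys p \<subseteq> A"
  shows "free_lift f p = (\<Sum>w\<in>A. Poly_Mapping.lookup p w *\<^sub>C f w)"
  unfolding free_lift_def
  by (rule sum.mono_neutral_left) (use assms in \<open>auto simp: in_keys_iff\<close>)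

lemma clinear_free_lift: "clinear (free_lift f)"
  unfolding clinear_iff
proof safe
  fix p q :: "'a \<Rightarrow>\<^sub>0 complex" and c :: complex
  let ?A = "Poly_Mapping.keys p \<union> Poly_Mapping.keys q"
  have sub: "Poly_Mapping.keys (p + q) \<subseteq> ?A" by (rule Poly_Mapping.keys_add)
  show "free_lift f (p + q) = free_lift f p + free_lift f q"
    by (simp add: free_lift_superset[OF _ sub] free_lift_superset[of ?A p] free_lift_superset[of ?A q]
        lookup_add scaleC_add_left sum.distrib)
  have "Poly_Mapping.keys (c *\<^sub>C p) \<subseteq> Poly_Mapping.keys p"
    by (auto simp: in_keys_iff lookup_scaleC)
  then show "free_lift f (c *\<^sub>C p) = c *\<^sub>C free_lift f p"
    by (simp add: free_lift_superset[of "Poly_Mapping.keys p"] lookup_scaleC scaleC_complex_def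
        cvec.scale_sum_right)
qed

lemma free_lift_single: "free_lift f (Poly_Mapping.single w 1) = f w"
  by (simp add: free_lift_def)

lemma tensor_eq_free_lift:
  assumes "multilinear f" "tensor_eq s t"
  shows "free_lift f s = free_lift f t"
proof -
  interpret L: Vector_Spaces.linear scaleC scaleC "free_lift f" by (rule clinear_free_lift)
  have "free_lift f r = 0" if "r \<in> tensor_relations" for r
    using that assms(1) unfolding tensor_relations_def multilinear_def clinear_iff
    by (auto simp: L.diff L.add L.scale free_lift_single)
  then have "free_lift f (s - t) = 0"
    using assms(2) cvec.span_zero L.eq_0_on_span unfolding tensor_eq_def by metis
  then show ?thesis by (simp add: L.diff)
qed

lemma free_span: "(p :: 'b \<Rightarrow>\<^sub>0 complex) = free_lift (\<lambda>w. Poly_Mapping.single w 1) p"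
proof (rule poly_mapping_eqI)
  fix k
  show "Poly_Mapping.lookup p k = Poly_Mapping.lookup (free_lift (\<lambda>w. Poly_Mapping.single w 1) p) k"
    by (simp add: free_lift_def Poly_Mapping.lookup_sum lookup_scaleC scaleC_complex_def
        lookup_single when_def in_keys_iff sum.delta if_distrib cong: if_cong)
qed

lemma tensor_span: "cvec.span (range tensor_word) = (UNIV :: 'a::complex_vec tensor set)"
proof (intro set_eqI iffI UNIV_I)
  fix t :: "'a tensor"
  obtain p where t: "t = abs_tensor p" using Quotient3_abs_rep[OF Quotient3_tensor] by metis
  have z: "abs_tensor (0 :: 'a list \<Rightarrow>\<^sub>0 complex) = 0" by (metis zero_tensor.abs_eq)
  have s: "abs_tensor (sum g A) = (\<Sum>x\<in>A. abs_tensor (g x))" if "finite A"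
    for g :: "'a list \<Rightarrow> 'a list \<Rightarrow>\<^sub>0 complex" and A
    using that by (induction) (auto simp: z plus_tensor.abs_eq[symmetric])
  have "t = (\<Sum>w\<in>Poly_Mapping.keys p. Poly_Mapping.lookup p w *\<^sub>C tensor_word w)"
    unfolding t by (subst free_span)
      (simp add: free_lift_def s scaleC_tensor.abs_eq[symmetric] tensor_word.abs_eq)
  also have "\<dots> \<in> cvec.span (range tensor_word)"
    by (intro cvec.span_sum cvec.span_scale cvec.span_base rangeI)
  finally show "t \<in> cvec.span (range tensor_word)" .
qed

lemma tensor_lift_unique:
  assumes "clinear F" "clinear F'" "\<And>w. F (tensor_word w) = F' (tensor_word w)"
  shows "F = F'"
proof
  fix t
  interpret F: Vector_Spaces.linear scaleC scaleC F by fact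
  interpret F': Vector_Spaces.linear scaleC scaleC F' by fact
  interpret D: Vector_Spaces.linear scaleC scaleC "\<lambda>t. F t - F' t"
    unfolding clinear_iff by (simp add: F.add F'.add F.scale F'.scale cvec.scale_right_diff_distrib)
  have "F t - F' t = 0"
    by (rule D.eq_0_on_span[of "range tensor_word"]) (use assms(3) in \<open>auto simp: tensor_span\<close>)
  then show "F t = F' t" by simp
qed

lemma
  assumes "multilinear f"
  shows clinear_tensor_lift: "clinear (tensor_lift f)"
    and tensor_lift_word: "tensor_lift f (tensor_word w) = f w"
proof -
  define F where "F t = free_lift f (rep_tensor t)" for t
  interpret L: Vector_Spaces.linear scaleC scaleC "free_lift f" by (rule clinear_free_lift)
  have F: "F (abs_tensor p) = free_lift f p" for p
    unfolding F_def
    by (rule tensor_eq_free_lift[OF assms])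
      (simp add: tensor.abs_eq_iff[symmetric] Quotient3_abs_rep[OF Quotient3_tensor])
  have "clinear F"
    unfolding clinear_iff
  proof safe
    fix x y :: "'a tensor" and c
    obtain p where p: "x = abs_tensor p" using Quotient3_abs_rep[OF Quotient3_tensor] by metis
    obtain q where q: "y = abs_tensor q" using Quotient3_abs_rep[OF Quotient3_tensor] by metis
    show "F (x + y) = F x + F y" by (simp add: p q plus_tensor.abs_eq F L.add)
    show "F (c *\<^sub>C x) = c *\<^sub>C F x" by (simp add: p scaleC_tensor.abs_eq F L.scale)
  qed
  moreover have "\<forall>w. F (tensor_word w) = f w"
    by (simp add: tensor_word.abs_eq F free_lift_single)
  ultimately have "\<exists>!F. clinear F \<and> (\<forall>w. F (tensor_word w) = f w)"
    by (intro ex1I[of _ F] conjI) (blast, blast, metis tensor_lift_unique)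
  from theI'[OF this] have "clinear (tensor_lift f) \<and> (\<forall>w. tensor_lift f (tensor_word w) = f w)"
    unfolding tensor_lift_def .
  then show "clinear (tensor_lift f)" "tensor_lift f (tensor_word w) = f w" by auto
qed

lemma multilinear_add: "multilinear f \<Longrightarrow> f (u @ (x + y) # v) = f (u @ x # v) + f (u @ y # v)"
  and multilinear_scale: "multilinear f \<Longrightarrow> f (u @ (c *\<^sub>C x) # v) = c *\<^sub>C f (u @ x # v)"
  by (simp_all add: multilinear_def clinear_iff)

lemma multilinear_tensor_word: "multilinear tensor_word"
  unfolding multilinear_def clinear_iff
proof (intro allI conjI)
  fix u v :: "'a list" and x y c
  have "Poly_Mapping.single (u @ (x + y) # v) 1 - Poly_Mapping.single (u @ x # v) 1
      - Poly_Mapping.single (u @ y # v) 1 \<in> cvec.span (tensor_relations :: ('a list \<Rightarrow>\<^sub>0 complex) set)"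
    by (rule cvec.span_base) (unfold tensor_relations_def, blast)
  then show "tensor_word (u @ (x + y) # v) = tensor_word (u @ x # v) + tensor_word (u @ y # v)"
    by (simp add: tensor_word.abs_eq plus_tensor.abs_eq tensor.abs_eq_iff tensor_eq_def diff_diff_eq)
  have "Poly_Mapping.single (u @ (c *\<^sub>C x) # v) 1 - c *\<^sub>C Poly_Mapping.single (u @ x # v) 1
      \<in> cvec.span (tensor_relations :: ('a list \<Rightarrow>\<^sub>0 complex) set)"
    by (rule cvec.span_base) (unfold tensor_relations_def, blast)
  then show "tensor_word (u @ (c *\<^sub>C x) # v) = c *\<^sub>C tensor_word (u @ x # v)"
    by (simp add: tensor_word.abs_eq scaleC_tensor.abs_eq tensor.abs_eq_iff tensor_eq_def)
qed

definition tensor_mult :: "'a::complex_vec tensor \<Rightarrow> 'a tensor \<Rightarrow> 'a tensor" (infixr "\<otimes>" 70) where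
  "s \<otimes> t = tensor_lift (\<lambda>u. tensor_lift (\<lambda>v. tensor_word (u @ v)) t) s"

lemma tensor_mult_word: "tensor_word u \<otimes> tensor_word v = tensor_word (u @ v)"
proof -
  have ml: "multilinear (\<lambda>v. tensor_word (u @ v))" for u :: "'a list"
    unfolding multilinear_def
  proof (intro allI)
    fix u' v
    show "clinear (\<lambda>x. tensor_word (u @ u' @ x # v))"
      using multilinear_tensor_word[unfolded multilinear_def, rule_format, of "u @ u'" v] by simp
  qed
  have ml': "multilinear (\<lambda>u. tensor_word (u @ v))" for v :: "'a list"
    unfolding multilinear_def clinear_iff
    by (simp add: multilinear_add[OF multilinear_tensor_word] multilinear_scale[OF multilinear_tensor_word])
  show ?thesis
    by (simp add: tensor_mult_def tensor_lift_word[OF ml] tensor_lift_word[OF ml'])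
qed

definition tensor_prod_list :: "'a::complex_vec tensor list \<Rightarrow> 'a tensor" where
  "tensor_prod_list ts = foldr (\<otimes>) ts (tensor_word [])"

text \<open>
  The tensor product \<open>f\<^sub>1 \<otimes> \<dots> \<otimes> f\<^sub>n\<close> of linear functionals, where \<open>f\<^sub>i\<close> is applied in degree
  \<open>d\<^sub>i\<close>; it lives in degree \<open>d\<^sub>1 + \<dots> + d\<^sub>n\<close> and is extended by zero to the other degrees. No
  Koszul signs appear, because it is only used for even functionals.
\<close>

fun split_eval :: "(nat \<times> ('a::complex_vec tensor \<Rightarrow> complex)) list \<Rightarrow> 'a list \<Rightarrow> complex" where
  "split_eval [] w = (if w = [] then 1 else 0)"
| "split_eval ((d, f) # fs) w =
     (if length w < d then 0 else f (tensor_word (take d w)) * split_eval fs (drop d w))"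

definition tensor_functional ::
    "(nat \<times> ('a::complex_vec tensor \<Rightarrow> complex)) list \<Rightarrow> 'a tensor \<Rightarrow> complex" where
  "tensor_functional fs = tensor_lift (split_eval fs)"

lemma multilinear_split_eval:
  assumes "\<And>d f. (d, f) \<in> set fs \<Longrightarrow> clinear f"
  shows "multilinear (split_eval fs)"
  using assms
proof (induction fs)
  case Nil
  then show ?case by (simp add: multilinear_def clinear_iff)
next
  case (Cons a fs)
  obtain d f where a: "a = (d, f)" by force
  have f: "clinear f" using Cons.prems[of d f] a by simp
  have IH: "multilinear (split_eval fs)"
    by (rule Cons.IH) (meson Cons.prems list.set_intros(2))
  show ?case
    unfolding multilinear_def a
  proof (intro allI)
    fix u v
    show "clinear (\<lambda>x. split_eval ((d, f) # fs) (u @ x # v))"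
    proof (cases "length u < d")
      case True
      then obtain m where m: "d - length u = Suc m" by (metis Suc_diff_Suc)
      show ?thesis
        unfolding clinear_iff
        using f[unfolded clinear_iff] True
        by (simp add: m scaleC_complex_def distrib_right
            multilinear_add[OF multilinear_tensor_word] multilinear_scale[OF multilinear_tensor_word])
    next
      case False
      then show ?thesis
        unfolding clinear_iff
        by (simp add: multilinear_add[OF IH] multilinear_scale[OF IH] scaleC_complex_def distrib_left)
    qed
  qed
qed


section \<open>Super vector spaces and super symmetric powers\<close>

text \<open>Parities are Booleans, with \<^const>\<open>True\<close> for odd.\<close>

class super_vec = complex_vec +
  fixes component :: "bool \<Rightarrow> 'a set"
  assumes component_zero: "0 \<in> component p"
    and component_add: "x \<in> component p \<Longrightarrow> y \<in> component p \<Longrightarrow> x + y \<in> component p"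
    and component_scale: "x \<in> component p \<Longrightarrow> c *\<^sub>C x \<in> component p"
    and component_disjoint: "component False \<inter> component True = {0}"
    and component_decomp: "\<exists>u\<in>component False. \<exists>v\<in>component True. x = u + v"

definition part :: "bool \<Rightarrow> 'a::super_vec \<Rightarrow> 'a" where
  "part p x = (THE u. u \<in> component p \<and> x - u \<in> component (\<not> p))"

lemma part_ex1: "\<exists>!u. u \<in> component p \<and> x - u \<in> component (\<not> p)"
proof -
  have sub: "a - b \<in> component q" if "a \<in> component q" "b \<in> component q" for a b :: 'a and q
    using component_add[OF that(1) component_scale[OF that(2), of "-1"]] by simp
  obtain u v where uv: "u \<in> component False" "v \<in> component True" "x = u + v"
    using component_decomp by blast
  show ?thesis
  proof (rule ex_ex1I)
    show "\<exists>u. u \<in> component p \<and> x - u \<in> component (\<not> p)"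
      using uv by (cases p) (force simp: algebra_simps)+
  next
    fix y z assume y: "y \<in> component p \<and> x - y \<in> component (\<not> p)"
      and z: "z \<in> component p \<and> x - z \<in> component (\<not> p)"
    have "y - z \<in> component p" using sub y z by blast
    moreover have "y - z \<in> component (\<not> p)" using sub[of "x - z" "\<not> p" "x - y"] y z by simp
    ultimately have "y - z \<in> component False \<inter> component True" by (cases p) auto
    then show "y = z" using component_disjoint[where 'a = 'a] by simp
  qed
qed

lemma part_eqI: "u \<in> component p \<Longrightarrow> x - u \<in> component (\<not> p) \<Longrightarrow> part p x = u"
  unfolding part_def using part_ex1 by (blast intro: the1_equality)

lemma part_in: "part p x \<in> component p" "x - part p x \<in> component (\<not> p)"
  using theI'[OF part_ex1, of p x] unfolding part_def by auto

lemma clinear_part: "clinear (part p :: 'a::super_vec \<Rightarrow> 'a)"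
  unfolding clinear_iff
proof safe
  fix x y :: 'a and c
  show "part p (x + y) = part p x + part p y"
    using component_add[OF part_in(1) part_in(1)] component_add[OF part_in(2) part_in(2), of x p y]
    by (intro part_eqI) (auto simp: algebra_simps)
  show "part p (c *\<^sub>C x) = c *\<^sub>C part p x"
    using component_scale[OF part_in(1)] component_scale[OF part_in(2), of c x p]
    by (intro part_eqI) (auto simp: cvec.scale_right_diff_distrib)
qed

text \<open>
  \<open>\<sigma>\<close> moves the letter in position \<open>i\<close> to position \<open>\<sigma> i\<close>. The sign of the permutation it
  induces on the odd letters is the parity of the number of inversions among them.
\<close>

definition koszul_sign :: "(nat \<Rightarrow> nat) \<Rightarrow> bool list \<Rightarrow> complex" where
  "koszul_sign \<sigma> ps =
     (-1) ^ card {(i, j). i < j \<and> j < length ps \<and> ps ! i \<and> ps ! j \<and> \<sigma> j < \<sigma> i}"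

text \<open>
  The action of \<open>\<sigma> \<in> S\<^sub>d\<close> on the \<open>d\<close>-th tensor power, extended by zero to the other degrees.
  A word of arbitrary vectors is first expanded into words of homogeneous vectors.
\<close>

definition koszul_word :: "nat \<Rightarrow> (nat \<Rightarrow> nat) \<Rightarrow> 'a::super_vec list \<Rightarrow> 'a tensor" where
  "koszul_word d \<sigma> w =
     (if length w = d
      then \<Sum>ps\<in>{ps. length ps = d}.
             koszul_sign \<sigma> ps *\<^sub>C tensor_word (permute_list (inv \<sigma>) (map2 part ps w))
      else 0)"

definition koszul_act :: "nat \<Rightarrow> (nat \<Rightarrow> nat) \<Rightarrow> 'a::super_vec tensor \<Rightarrow> 'a tensor" where
  "koszul_act d \<sigma> = tensor_lift (koszul_word d \<sigma>)"

lemma multilinear_koszul_word: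
  assumes "\<sigma> permutes {..<d}"
  shows "multilinear (koszul_word d \<sigma> :: 'a::super_vec list \<Rightarrow> 'a tensor)"
  unfolding multilinear_def
proof (intro allI)
  fix u v :: "'a list"
  show "clinear (\<lambda>x. koszul_word d \<sigma> (u @ x # v))"
  proof (cases "length (u @ undefined # v) = d")
    case False
    then show ?thesis by (simp add: koszul_word_def clinear_iff)
  next
    case True
    have lin: "clinear (\<lambda>x. tensor_word (permute_list (inv \<sigma>) (map2 part ps (u @ x # v))))"
      if "length ps = d" for ps
    proof -
      let ?n = "length u"
      let ?j = "\<sigma> ?n"
      have j: "?j < d" using assms True permutes_in_image[OF assms, of ?n] by simp
      define w0 where "w0 = permute_list (inv \<sigma>) (map2 part ps (u @ 0 # v))"
      have "permute_list (inv \<sigma>) (map2 part ps (u @ x # v)) = take ?j w0 @ part (ps ! ?n) x # drop (Suc ?j) w0" for x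
      proof (rule nth_equalityI)
        show len: "length (permute_list (inv \<sigma>) (map2 part ps (u @ x # v))) =
            length (take ?j w0 @ part (ps ! ?n) x # drop (Suc ?j) w0)"
          using j True that by (simp add: w0_def)
        fix i assume "i < length (permute_list (inv \<sigma>) (map2 part ps (u @ x # v)))"
        then have i: "i < d" using True that by simp
        have ii: "inv \<sigma> i < d" using permutes_in_image[OF permutes_inv[OF assms], of i] i by simp
        have eq: "inv \<sigma> i = ?n \<longleftrightarrow> i = ?j" using assms permutes_inv_eq[OF assms] by auto
        show "permute_list (inv \<sigma>) (map2 part ps (u @ x # v)) ! i =
            (take ?j w0 @ part (ps ! ?n) x # drop (Suc ?j) w0) ! i"
          using i ii j True that eq
          by (auto simp: w0_def permute_list_def nth_append nth_Cons' min_def)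
      qed
      then show ?thesis
        using clinear_part[where 'a = 'a and p = "ps ! ?n"]
        unfolding clinear_iff
        by (simp add: multilinear_add[OF multilinear_tensor_word] multilinear_scale[OF multilinear_tensor_word])
    qed
    have "clinear (\<lambda>x. \<Sum>ps\<in>{ps. length ps = d}.
        koszul_sign \<sigma> ps *\<^sub>C tensor_word (permute_list (inv \<sigma>) (map2 part ps (u @ x # v))))"
      unfolding clinear_iff
    proof (intro conjI allI, goal_cases)
      case (1 x y)
      show ?case
        unfolding sum.distrib[symmetric]
        by (intro sum.cong refl) (use lin in \<open>simp add: clinear_iff scaleC_add_right\<close>)
    next
      case (2 c x)
      show ?case
        unfolding cvec.scale_sum_right
        by (intro sum.cong refl) (use lin in \<open>simp add: clinear_iff mult.commute\<close>)
    qed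
    then show ?thesis
      using True by (simp add: koszul_word_def)
  qed
qed

lemma koszul_act_word:
  assumes "\<sigma> permutes {..<d}"
  shows "koszul_act d \<sigma> (tensor_word w) = koszul_word d \<sigma> w"
  unfolding koszul_act_def by (rule tensor_lift_word[OF multilinear_koszul_word[OF assms]])

text \<open>The direct sum over \<open>d\<close> of the coinvariants of the \<open>d\<close>-th tensor powers.\<close>

definition sym_relations :: "'a::super_vec tensor set" where
  "sym_relations = {koszul_act d \<sigma> t - t | d \<sigma> t. \<sigma> permutes {..<d} \<and> t \<in> tensor_power d}"

definition sym_eq :: "'a::super_vec tensor \<Rightarrow> 'a tensor \<Rightarrow> bool" where
  "sym_eq s t \<longleftrightarrow> s - t \<in> cvec.span sym_relations"

quotient_type (overloaded) 'a super_sym = "'a::super_vec tensor" / sym_eq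
  morphisms rep_super_sym super_sym_proj
  unfolding sym_eq_def by (rule equivp_diff_span)

notation super_sym_proj (\<open>\<varpi>\<close>)

instantiation super_sym :: (super_vec) complex_vec
begin

lift_definition zero_super_sym :: "'a super_sym" is 0 .

lift_definition plus_super_sym :: "'a super_sym \<Rightarrow> 'a super_sym \<Rightarrow> 'a super_sym" is "(+)"
  unfolding sym_eq_def by (rule span_diff_plus)

lift_definition minus_super_sym :: "'a super_sym \<Rightarrow> 'a super_sym \<Rightarrow> 'a super_sym" is "(-)"
  unfolding sym_eq_def by (rule span_diff_diff)

lift_definition uminus_super_sym :: "'a super_sym \<Rightarrow> 'a super_sym" is uminus
  unfolding sym_eq_def by (rule span_diff_minus)

lift_definition scaleC_super_sym :: "complex \<Rightarrow> 'a super_sym \<Rightarrow> 'a super_sym" is scaleC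
  unfolding sym_eq_def by (rule span_diff_scale)

instance
  by standard (transfer; simp add: sym_eq_def cvec.span_zero algebra_simps
      scaleC_add_right scaleC_add_left)+

end

text \<open>
  For even \<open>x\<^sub>1, \<dots>, x\<^sub>a\<close> and odd \<open>y\<^sub>1, \<dots>, y\<^sub>j\<close> this is
  \<open>x\<^sub>1 \<odot> \<dots> \<odot> x\<^sub>a \<otimes> y\<^sub>1 \<and> \<dots> \<and> y\<^sub>j\<close> under the canonical identification of the super symmetric
  algebra with \<open>Sym V\<^sub>0 \<otimes> \<Lambda> V\<^sub>1\<close>.
\<close>

definition sym_ext :: "'a::super_vec list \<Rightarrow> 'a list \<Rightarrow> 'a super_sym" where
  "sym_ext xs ys = \<varpi> (tensor_word (xs @ ys))"

definition vanishes_odd :: "('a::super_vec super_sym \<Rightarrow> complex) \<Rightarrow> bool" where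
  "vanishes_odd h \<longleftrightarrow>
     (\<forall>xs ys. set xs \<subseteq> component False \<longrightarrow> set ys \<subseteq> component True \<longrightarrow> odd (length ys) \<longrightarrow>
        h (sym_ext xs ys) = 0)"


section \<open>The bilinear form and adapted coordinates\<close>

definition bilinear_form :: "('a::complex_vec \<Rightarrow> 'a \<Rightarrow> complex) \<Rightarrow> bool" where
  "bilinear_form b \<longleftrightarrow> (\<forall>x. clinear (b x)) \<and> (\<forall>y. clinear (\<lambda>x. b x y))"

definition nondegenerate_form :: "('a::complex_vec \<Rightarrow> 'a \<Rightarrow> complex) \<Rightarrow> bool" where
  "nondegenerate_form b \<longleftrightarrow>
     (\<forall>x. (\<forall>y. b x y = 0) \<longrightarrow> x = 0) \<and> (\<forall>y. (\<forall>x. b x y = 0) \<longrightarrow> y = 0)"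

definition even_form :: "('a::super_vec \<Rightarrow> 'a \<Rightarrow> complex) \<Rightarrow> bool" where
  "even_form b \<longleftrightarrow> (\<forall>x\<in>component False. \<forall>y\<in>component True. b x y = 0 \<and> b y x = 0)"

definition supersymmetric_form :: "('a::super_vec \<Rightarrow> 'a \<Rightarrow> complex) \<Rightarrow> bool" where
  "supersymmetric_form b \<longleftrightarrow>
     (\<forall>p q. \<forall>x\<in>component p. \<forall>y\<in>component q. b x y = (if p \<and> q then - 1 else 1) * b y x)"

definition basis_family :: "nat \<Rightarrow> (nat \<Rightarrow> 'a::complex_vec) \<Rightarrow> 'a set \<Rightarrow> bool" where
  "basis_family n x S \<longleftrightarrow>
     inj_on x {1..n} \<and> \<not> cvec.dependent (x ` {1..n}) \<and> cvec.span (x ` {1..n}) = S"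

definition adapted_coordinates ::
    "('a::super_vec \<Rightarrow> 'a \<Rightarrow> complex) \<Rightarrow> nat \<Rightarrow> (nat \<Rightarrow> 'a) \<Rightarrow> nat \<Rightarrow> (nat \<Rightarrow> 'a) \<Rightarrow> bool" where
  "adapted_coordinates b k e l \<xi> \<longleftrightarrow>
     basis_family k e (component False) \<and>
     basis_family (2 * l) \<xi> (component True) \<and>
     (\<forall>i\<in>{1..k}. \<forall>j\<in>{1..k}. b (e i) (e j) = (if i = j then 1 else 0)) \<and>
     (\<forall>i\<in>{1..2 * l}. \<forall>j\<in>{1..2 * l}.
        b (\<xi> i) (\<xi> j) = (if j = i + l then 1 else if i = j + l then - 1 else 0))"

definition eta :: "nat \<Rightarrow> (nat \<Rightarrow> 'a::complex_vec) \<Rightarrow> nat \<Rightarrow> 'a" where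
  "eta l \<xi> i = (if i \<le> l then - \<xi> (i + l) else \<xi> (i - l))"

definition twisted_element ::
    "nat \<Rightarrow> (nat \<Rightarrow> 'a::complex_vec) \<Rightarrow> nat \<Rightarrow> (nat \<Rightarrow> 'a) \<Rightarrow> 'a tensor" where
  "twisted_element k e l \<xi> =
     (\<Sum>i\<in>{1..k}. tensor_word [e i, e i]) - (\<Sum>i\<in>{1..2 * l}. tensor_word [\<xi> i, eta l \<xi> i])"


section \<open>Graphs\<close>

text \<open>
  The half-edges of an edge \<open>f\<close> are \<open>(f, False)\<close> and \<open>(f, True)\<close>, lying at \<open>ends G f False\<close> and
  \<open>ends G f True\<close>. Free circles are not represented.
\<close>

record ('v, 'e) multigraph =
  verts :: "'v set"
  edges :: "'e set"
  ends :: "'e \<Rightarrow> bool \<Rightarrow> 'v"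

type_synonym 'e half_edge = "'e \<times> bool"

definition finite_multigraph :: "('v, 'e) multigraph \<Rightarrow> bool" where
  "finite_multigraph G \<longleftrightarrow>
     finite (verts G) \<and> finite (edges G) \<and> (\<forall>f\<in>edges G. \<forall>s. ends G f s \<in> verts G)"

definition half_edges_at :: "('v, 'e) multigraph \<Rightarrow> 'e set \<Rightarrow> 'v \<Rightarrow> 'e half_edge set" where
  "half_edges_at G F v = {(f, s). f \<in> F \<and> ends G f s = v}"

definition deg :: "('v, 'e) multigraph \<Rightarrow> 'v \<Rightarrow> nat" where
  "deg G v = card (half_edges_at G (edges G) v)"

definition eulerian :: "('v, 'e) multigraph \<Rightarrow> 'e set \<Rightarrow> bool" where
  "eulerian G F \<longleftrightarrow> F \<subseteq> edges G \<and> (\<forall>v\<in>verts G. even (card (half_edges_at G F v)))"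


section \<open>Tensor networks\<close>

text \<open>
  The choices entering a tensor network are an order \<open>es\<close> of the edges, an assignment \<open>s\<close> of the
  tensor legs (the first leg of the factor at \<open>f\<close> goes to \<open>(f, s f)\<close>, the second one to the other
  half-edge), an order \<open>vs\<close> of the vertices and orders \<open>hs v\<close> of the half-edges at \<open>v\<close>.
\<close>

definition network_order ::
    "('v, 'e) multigraph \<Rightarrow> 'e list \<Rightarrow> 'v list \<Rightarrow> ('v \<Rightarrow> 'e half_edge list) \<Rightarrow> bool" where
  "network_order G es vs hs \<longleftrightarrow>
     distinct es \<and> set es = edges G \<and> distinct vs \<and> set vs = verts G \<and>
     (\<forall>v\<in>verts G. distinct (hs v) \<and> set (hs v) = half_edges_at G (edges G) v)"

text \<open>The permutation moving each entry of \<open>xs\<close> to its position in the rearrangement \<open>ys\<close>.\<close>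

definition rearrangement :: "'b list \<Rightarrow> 'b list \<Rightarrow> nat \<Rightarrow> nat" where
  "rearrangement xs ys i =
     (if i < length xs then THE j. j < length ys \<and> ys ! j = xs ! i else i)"

definition legs_edge_order :: "'e list \<Rightarrow> ('e \<Rightarrow> bool) \<Rightarrow> 'e half_edge list" where
  "legs_edge_order es s = concat (map (\<lambda>f. [(f, s f), (f, \<not> s f)]) es)"

definition legs_vertex_order :: "'v list \<Rightarrow> ('v \<Rightarrow> 'e half_edge list) \<Rightarrow> 'e half_edge list" where
  "legs_vertex_order vs hs = concat (map hs vs)"

definition regroup ::
    "'e list \<Rightarrow> ('e \<Rightarrow> bool) \<Rightarrow> 'v list \<Rightarrow> ('v \<Rightarrow> 'e half_edge list) \<Rightarrow>
     'a::super_vec tensor \<Rightarrow> 'a tensor" where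
  "regroup es s vs hs =
     koszul_act (length (legs_edge_order es s))
       (rearrangement (legs_edge_order es s) (legs_vertex_order vs hs))"

text \<open>
  A single functional \<open>h\<close> on the super symmetric algebra encodes the family of its restrictions
  \<open>h\<^sub>d\<close> to the super symmetric powers. For \<open>D\<close> even and invariant under the super symmetry the
  value does not depend on the choices \<open>es\<close>, \<open>s\<close>, \<open>vs\<close>, \<open>hs\<close>.
\<close>

definition tensor_network ::
    "('a::super_vec super_sym \<Rightarrow> complex) \<Rightarrow> 'a tensor \<Rightarrow> ('v, 'e) multigraph \<Rightarrow>
     'e list \<Rightarrow> ('e \<Rightarrow> bool) \<Rightarrow> 'v list \<Rightarrow> ('v \<Rightarrow> 'e half_edge list) \<Rightarrow> complex" where
  "tensor_network h D G es s vs hs =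
     tensor_functional (map (\<lambda>v. (deg G v, h \<circ> \<varpi>)) vs)
       (regroup es s vs hs (tensor_prod_list (map (\<lambda>_. D) es)))"


section \<open>The sum over Eulerian subsets\<close>

text \<open>
  An orientation \<open>\<omega>\<close> makes \<open>f\<close> leave its vertex along the half-edge \<open>(f, \<omega> f)\<close> and arrive along
  \<open>(f, \<not> \<omega> f)\<close>.
\<close>

definition outgoing :: "('v, 'e) multigraph \<Rightarrow> 'e set \<Rightarrow> ('e \<Rightarrow> bool) \<Rightarrow> 'v \<Rightarrow> 'e half_edge set" where
  "outgoing G F \<omega> v = {(f, t) \<in> half_edges_at G F v. t = \<omega> f}"

definition incoming :: "('v, 'e) multigraph \<Rightarrow> 'e set \<Rightarrow> ('e \<Rightarrow> bool) \<Rightarrow> 'v \<Rightarrow> 'e half_edge set" where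
  "incoming G F \<omega> v = {(f, t) \<in> half_edges_at G F v. t \<noteq> \<omega> f}"

definition balanced_orientation :: "('v, 'e) multigraph \<Rightarrow> 'e set \<Rightarrow> ('e \<Rightarrow> bool) \<Rightarrow> bool" where
  "balanced_orientation G F \<omega> \<longleftrightarrow>
     (\<forall>v\<in>verts G. card (incoming G F \<omega> v) = card (outgoing G F \<omega> v))"

definition local_pairing ::
    "('v, 'e) multigraph \<Rightarrow> 'e set \<Rightarrow> ('e \<Rightarrow> bool) \<Rightarrow>
     ('v \<Rightarrow> ('e half_edge \<times> 'e half_edge) set) \<Rightarrow> bool" where
  "local_pairing G F \<omega> \<kappa> \<longleftrightarrow>
     (\<forall>v\<in>verts G. bij_betw fst (\<kappa> v) (incoming G F \<omega> v) \<and> bij_betw snd (\<kappa> v) (outgoing G F \<omega> v))"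

text \<open>
  A pair \<open>(a\<^sub>1, a\<^sub>2)\<close> leads from the edge of \<open>a\<^sub>1\<close> to the edge of \<open>a\<^sub>2\<close>. This relation is the graph of a
  permutation of \<open>F\<close>, whose cycles are the directed circuits; the circuit through \<open>f\<close> is the set
  of edges reachable from \<open>f\<close>.
\<close>

definition edge_successor ::
    "('v, 'e) multigraph \<Rightarrow> ('v \<Rightarrow> ('e half_edge \<times> 'e half_edge) set) \<Rightarrow> ('e \<times> 'e) set" where
  "edge_successor G \<kappa> = {(fst a1, fst a2) | v a1 a2. v \<in> verts G \<and> (a1, a2) \<in> \<kappa> v}"

definition circuit_count ::
    "('v, 'e) multigraph \<Rightarrow> 'e set \<Rightarrow> ('v \<Rightarrow> ('e half_edge \<times> 'e half_edge) set) \<Rightarrow> nat" where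
  "circuit_count G F \<kappa> = card ((\<lambda>f. (edge_successor G \<kappa>)\<^sup>* `` {f}) ` F)"

text \<open>
  An enumeration of a finite set. Below the order does not matter: even vectors and products
  \<open>\<xi> \<and> \<eta>\<close> of two odd ones commute in the super symmetric algebra.
\<close>

definition enum_list :: "'b set \<Rightarrow> 'b list" where
  "enum_list A = (SOME xs. distinct xs \<and> set xs = A)"

definition vertex_value ::
    "('a::super_vec super_sym \<Rightarrow> complex) \<Rightarrow> (nat \<Rightarrow> 'a) \<Rightarrow> nat \<Rightarrow> (nat \<Rightarrow> 'a) \<Rightarrow>
     'e half_edge set \<Rightarrow> ('e half_edge \<times> 'e half_edge) set \<Rightarrow>
     ('e \<Rightarrow> nat) \<Rightarrow> ('e \<Rightarrow> nat) \<Rightarrow> complex" where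
  "vertex_value h e l \<xi> A K \<psi> \<phi> =
     h (sym_ext
          (map (\<lambda>a. e (\<psi> (fst a))) (enum_list A))
          (concat (map (\<lambda>(a1, a2). [\<xi> (\<phi> (fst a1)), eta l \<xi> (\<phi> (fst a2))]) (enum_list K))))"

text \<open>\<open>\<kappa> F\<close> is the local pairing chosen for the Eulerian subset \<open>F\<close>.\<close>

definition eulerian_sum ::
    "('a::super_vec super_sym \<Rightarrow> complex) \<Rightarrow> nat \<Rightarrow> (nat \<Rightarrow> 'a) \<Rightarrow> nat \<Rightarrow> (nat \<Rightarrow> 'a) \<Rightarrow>
     ('v, 'e) multigraph \<Rightarrow> ('e set \<Rightarrow> 'v \<Rightarrow> ('e half_edge \<times> 'e half_edge) set) \<Rightarrow> complex" where
  "eulerian_sum h k e l \<xi> G \<kappa> =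
     (\<Sum>F | eulerian G F. (-1) ^ circuit_count G F (\<kappa> F) *
        (\<Sum>\<psi> \<in> (edges G - F) \<rightarrow>\<^sub>E {1..k}. \<Sum>\<phi> \<in> F \<rightarrow>\<^sub>E {1..2 * l}.
           \<Prod>v\<in>verts G. vertex_value h e l \<xi> (half_edges_at G (edges G - F) v) (\<kappa> F v) \<psi> \<phi>))"

end

theory Submission
  imports Defs "HOL-Combinatorics.Orbits"
begin

text \<open>
  Both sides are sums over the same data. Write the twisted element as the even part
  \<open>\<Sum> e\<^sub>i \<otimes> e\<^sub>i\<close> plus the odd part \<open>- \<Sum> \<xi>\<^sub>i \<otimes> \<eta>\<^sub>i\<close> and expand the product over the edges: the edges
  taking the odd part form a subset \<open>F\<close>, and choosing a summand at every edge gives the colourings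
  \<open>\<psi>\<close> and \<open>\<phi>\<close> (\<open>twisted_element_power\<close>). Each summand is a word of homogeneous vectors indexed by the
  half-edges, so that regrouping merely permutes it and multiplies it by a sign, the parity of the
  number of pairs of half-edges of \<open>F\<close> whose order is reversed (\<open>koszul_act_homogeneous\<close>). If some
  vertex meets \<open>F\<close> in an odd number of half-edges, then \<open>h\<close> kills its word because \<open>h\<close> vanishes in
  odd exterior degree; only Eulerian \<open>F\<close> survive.

  For Eulerian \<open>F\<close> everything comes down to one sign. The odd part of the twisted element
  can be written in two ways, \<open>- \<Sum> \<xi>\<^sub>i \<otimes> \<eta>\<^sub>i = \<Sum> \<eta>\<^sub>i \<otimes> \<xi>\<^sub>i\<close> (\<open>twisted_element_odd_flip\<close>), so every edge
  of \<open>F\<close> may be written with \<open>\<eta>\<close> at its tail followed by \<open>\<xi>\<close> at its head, with coefficient \<open>1\<close>.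
  The legs of a directed circuit \<open>f\<^sub>1, \<dots>, f\<^sub>m\<close> then read
  \<open>tail f\<^sub>1, head f\<^sub>1, \<dots>, tail f\<^sub>m, head f\<^sub>m\<close>, whereas the local pairing asks for the pairs
  \<open>(head f\<^sub>1, tail f\<^sub>2), \<dots>, (head f\<^sub>m, tail f\<^sub>1)\<close>. Moving the single letter \<open>tail f\<^sub>1\<close> to the end passes
  \<open>2 m - 1\<close> odd letters and costs \<open>-1\<close>; and whole pairs commute with each other, so they can be
  collected at their vertices for free. The total sign is therefore \<open>-1\<close> for each circuit
  (\<open>order_sign_circuits\<close>, \<open>eulerian_sign\<close>).
\<close>


section \<open>Signs of reorderings\<close>

fun before :: "'b list \<Rightarrow> ('b \<times> 'b) set" where
  "before [] = {}"
| "before (x # xs) = {x} \<times> set xs \<union> before xs"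

text \<open>
  The sign of the permutation carrying \<open>xs\<close> to \<open>ys\<close>, for lists without repetitions and with the
  same entries: the intersection consists of the pairs whose order is reversed. Working with orders
  of entries instead of permutations of positions makes concatenation and filtering transparent.
\<close>

definition order_sign :: "'b list \<Rightarrow> 'b list \<Rightarrow> complex" where
  "order_sign xs ys = (-1) ^ card (before xs \<inter> (before ys)\<inverse>)"

lemma before_append: "before (xs @ ys) = before xs \<union> set xs \<times> set ys \<union> before ys"
  by (induction xs) auto

lemma before_subset: "before xs \<subseteq> set xs \<times> set xs"
  by (induction xs) auto

lemma finite_before: "finite (before xs)"
  by (rule finite_subset[OF before_subset]) simp

lemma before_antisym: "distinct xs \<Longrightarrow> (a, b) \<in> before xs \<Longrightarrow> (b, a) \<notin> before xs"
  by (induction xs) (use before_subset in fastforce)+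

lemma before_irrefl: "distinct xs \<Longrightarrow> (a, a) \<notin> before xs"
  by (induction xs) (use before_subset in fastforce)+

lemma before_total: "a \<in> set xs \<Longrightarrow> b \<in> set xs \<Longrightarrow> a \<noteq> b \<Longrightarrow> (a, b) \<in> before xs \<or> (b, a) \<in> before xs"
  by (induction xs) auto

lemma before_filter: "before (filter P xs) = {(a, b) \<in> before xs. P a \<and> P b}"
  by (induction xs) auto

lemma before_conv_nth: "before xs = {(xs ! i, xs ! j) | i j. i < j \<and> j < length xs}"
proof (induction xs)
  case (Cons x xs)
  have "(\<exists>i j. a = (x # xs) ! i \<and> b = (x # xs) ! j \<and> i < j \<and> j < Suc (length xs)) \<longleftrightarrow>
      a = x \<and> b \<in> set xs \<or> (\<exists>i j. a = xs ! i \<and> b = xs ! j \<and> i < j \<and> j < length xs)"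
    (is "?L \<longleftrightarrow> ?R") for a b
  proof
    assume ?L
    then obtain i j where ij: "a = (x # xs) ! i" "b = (x # xs) ! j" "i < j" "j < Suc (length xs)"
      by blast
    then obtain j' where j': "j = Suc j'" by (cases j) auto
    show ?R
    proof (cases i)
      case 0
      then show ?thesis using ij j' by auto
    next
      case (Suc i')
      then show ?thesis using ij j' by auto
    qed
  next
    assume ?R
    then show ?L
    proof
      assume "a = x \<and> b \<in> set xs"
      then obtain j where "a = x" "b = xs ! j" "j < length xs" by (auto simp: in_set_conv_nth)
      then show ?L by (intro exI[of _ 0] exI[of _ "Suc j"]) simp
    next
      assume "\<exists>i j. a = xs ! i \<and> b = xs ! j \<and> i < j \<and> j < length xs"
      then obtain i j where "a = xs ! i" "b = xs ! j" "i < j" "j < length xs" by blast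
      then show ?L by (intro exI[of _ "Suc i"] exI[of _ "Suc j"]) simp
    qed
  qed
  then have "(a, b) \<in> before (x # xs) \<longleftrightarrow>
      (a, b) \<in> {((x # xs) ! i, (x # xs) ! j) | i j. i < j \<and> j < length (x # xs)}" for a b
    unfolding before.simps Cons.IH by simp
  then show ?case by (simp add: set_eq_iff)
qed simp

lemma order_sign_refl: "distinct xs \<Longrightarrow> order_sign xs xs = 1"
proof -
  assume "distinct xs"
  then have "before xs \<inter> (before xs)\<inverse> = {}" using before_antisym by fastforce
  then show ?thesis by (simp add: order_sign_def)
qed

text \<open>
  A pair is reversed between \<open>ys\<close> and \<open>zs\<close> exactly when it is reversed between \<open>xs\<close> and one, but not
  both, of \<open>ys\<close> and \<open>zs\<close>. So the three sets of reversed pairs are related by a symmetric difference,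
  and cardinalities of symmetric differences add modulo \<open>2\<close>.
\<close>

lemma order_sign_trans:
  assumes "distinct xs" "distinct ys" "distinct zs" "set xs = set ys" "set ys = set zs"
  shows "order_sign xs ys * order_sign ys zs = order_sign xs zs"
proof -
  define I where "I = before xs \<inter> (before ys)\<inverse>"
  define J where "J = before xs \<inter> (before zs)\<inverse>"
  have fin: "finite I" "finite J" by (auto simp: I_def J_def finite_before)
  \<comment> \<open>A pair reversed between \<open>ys\<close> and \<open>zs\<close> is listed in the order of \<open>ys\<close>, hence the converse in the second part.\<close>
  have "before ys \<inter> (before zs)\<inverse> = (J - I) \<union> (I - J)\<inverse>" (is "?L = ?R")
  proof
    show "?L \<subseteq> ?R"
    proof
      fix p assume "p \<in> ?L"
      then obtain a b where p: "p = (a, b)" "(a, b) \<in> before ys" "(b, a) \<in> before zs" by auto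
      then have "a \<in> set xs" "b \<in> set xs" "a \<noteq> b"
        using before_subset[of ys] before_irrefl[of ys] assms by auto
      then show "p \<in> ?R"
        using before_total[of a xs b] p before_antisym[of ys a b] before_antisym[of zs b a] assms
        by (auto simp: I_def J_def)
    qed
    show "?R \<subseteq> ?L"
    proof
      fix p assume "p \<in> ?R"
      moreover obtain a b where p: "p = (a, b)" by force
      ultimately consider "(a, b) \<in> J - I" | "(b, a) \<in> I - J" by auto
      then show "p \<in> ?L"
      proof cases
        case 1
        then have "a \<in> set xs" "b \<in> set xs" "a \<noteq> b"
          using before_subset[of xs] before_irrefl[of xs] assms by (auto simp: J_def)
        then show ?thesis using 1 before_total[of a ys b] assms by (auto simp: I_def J_def p)
      next
        case 2
        then have "a \<in> set xs" "b \<in> set xs" "a \<noteq> b"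
          using before_subset[of xs] before_irrefl[of xs] assms by (auto simp: I_def)
        then show ?thesis using 2 before_total[of a zs b] assms by (auto simp: I_def J_def p)
      qed
    qed
  qed
  moreover have "(J - I) \<inter> (I - J)\<inverse> = {}"
    using before_antisym[OF assms(1)] by (auto simp: I_def J_def)
  ultimately have "card (before ys \<inter> (before zs)\<inverse>) = card (J - I) + card (I - J)"
    using fin by (subst card_inverse[symmetric, of "I - J"]) (simp add: card_Un_disjoint del: card_inverse)
  moreover have "card I = card (I \<inter> J) + card (I - J)" "card J = card (I \<inter> J) + card (J - I)"
    using fin by (simp_all add: card_Int_Diff[of I J] card_Int_Diff[of J I] Int_commute)
  ultimately have "card I + card (before ys \<inter> (before zs)\<inverse>) = card J + 2 * card (I - J)"
    by simp
  then show ?thesis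
    unfolding order_sign_def I_def[symmetric] J_def[symmetric] power_add[symmetric]
    by (simp add: power_add power_mult)
qed

lemma order_sign_append:
  assumes "distinct (xs @ us)" "set xs = set ys" "set us = set vs"
  shows "order_sign (xs @ us) (ys @ vs) = order_sign xs ys * order_sign us vs"
proof -
  have disj: "set xs \<inter> set us = {}" using assms by simp
  have sub: "before xs \<subseteq> set xs \<times> set xs" "before ys \<subseteq> set xs \<times> set xs"
    "before us \<subseteq> set us \<times> set us" "before vs \<subseteq> set us \<times> set us"
    using assms before_subset by metis+
  have "before (xs @ us) \<inter> (before (ys @ vs))\<inverse> =
      (before xs \<inter> (before ys)\<inverse>) \<union> (before us \<inter> (before vs)\<inverse>)"
    unfolding before_append assms(2,3)[symmetric] using disj sub by blast
  moreover have "(before xs \<inter> (before ys)\<inverse>) \<inter> (before us \<inter> (before vs)\<inverse>) = {}"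
    using sub disj by blast
  ultimately show ?thesis
    by (simp add: order_sign_def card_Un_disjoint finite_before power_add)
qed

lemma order_sign_swap:
  assumes "distinct (xs @ ys)"
  shows "order_sign (xs @ ys) (ys @ xs) = (-1) ^ (length xs * length ys)"
proof -
  have disj: "set xs \<inter> set ys = {}" and d: "distinct xs" "distinct ys" using assms by auto
  have "before (xs @ ys) \<inter> (before (ys @ xs))\<inverse> = set xs \<times> set ys" (is "?L = ?R")
  proof
    show "?R \<subseteq> ?L" unfolding before_append by blast
    show "?L \<subseteq> ?R"
      unfolding before_append
      using disj before_subset[of xs] before_subset[of ys] before_antisym[OF d(1)] before_antisym[OF d(2)]
      by blast
  qed
  then show ?thesis
    using d by (simp add: order_sign_def card_cartesian_product distinct_card)
qed

lemma distinct_concat_map: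
  "distinct xs \<Longrightarrow> distinct (concat (map B xs)) \<longleftrightarrow>
     (\<forall>x\<in>set xs. distinct (B x)) \<and> (\<forall>x\<in>set xs. \<forall>y\<in>set xs. x \<noteq> y \<longrightarrow> set (B x) \<inter> set (B y) = {})"
proof (induction xs)
  case (Cons a xs)
  then have "\<forall>y\<in>set xs. a \<noteq> y \<and> y \<noteq> a" by auto
  then have "(\<forall>x\<in>set (a # xs). \<forall>y\<in>set (a # xs). x \<noteq> y \<longrightarrow> set (B x) \<inter> set (B y) = {}) \<longleftrightarrow>
      (\<forall>y\<in>set xs. set (B a) \<inter> set (B y) = {}) \<and>
      (\<forall>x\<in>set xs. \<forall>y\<in>set xs. x \<noteq> y \<longrightarrow> set (B x) \<inter> set (B y) = {})"
    by (simp add: ball_conj_distrib Int_commute[of _ "set (B a)"])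
  moreover have "distinct (concat (map B (a # xs))) \<longleftrightarrow> distinct (B a) \<and>
      distinct (concat (map B xs)) \<and> (\<forall>y\<in>set xs. set (B a) \<inter> set (B y) = {})"
    by auto
  ultimately show ?case
    using Cons.IH Cons.prems by (simp add: conj_ac)
qed simp

lemma order_sign_concat:
  assumes "distinct (concat (map B xs))" "\<And>x. x \<in> set xs \<Longrightarrow> set (B x) = set (C x)"
  shows "order_sign (concat (map B xs)) (concat (map C xs)) = prod_list (map (\<lambda>x. order_sign (B x) (C x)) xs)"
  using assms
proof (induction xs)
  case Nil
  then show ?case by (simp add: order_sign_def)
next
  case (Cons x xs)
  have "set (concat (map B xs)) = set (concat (map C xs))" using Cons.prems(2) by auto
  then show ?case
    using Cons by (simp add: order_sign_append)
qed

text \<open>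
  Blocks of even length commute with everything, so their order is immaterial. In the induction the
  first block of \<open>xs\<close> is pushed to its place in \<open>ys\<close>; the number of transpositions is its even length
  times the number of letters it passes.
\<close>

lemma order_sign_even_blocks:
  assumes "distinct xs" "distinct ys" "set xs = set ys" "distinct (concat (map B xs))"
    "\<And>x. x \<in> set xs \<Longrightarrow> even (length (B x))"
  shows "order_sign (concat (map B xs)) (concat (map B ys)) = 1"
  using assms
proof (induction xs arbitrary: ys)
  case Nil
  then show ?case by (simp add: order_sign_def)
next
  case (Cons x xs)
  obtain us vs where ys: "ys = us @ x # vs"
    using Cons.prems(3) by (metis list.set_intros(1) split_list)
  let ?c = "\<lambda>zs. concat (map B zs)"
  have s: "set xs = set (us @ vs)" using Cons.prems(1,2,3) ys by auto
  have sc: "set (?c xs) = set (?c us) \<union> set (?c vs)" using s by auto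
  have IH: "order_sign (?c xs) (?c (us @ vs)) = 1"
    using Cons.prems ys s by (intro Cons.IH) auto
  have perm: "distinct (?c zs)" if "distinct zs" "set zs \<subseteq> set (x # xs)" for zs
    using that Cons.prems(4)
    unfolding distinct_concat_map[OF Cons.prems(1)] distinct_concat_map[OF that(1)] by blast
  have dist: "distinct (?c us @ B x @ ?c vs)"
  proof -
    have "distinct (?c ys)" by (rule perm) (use Cons.prems in auto)
    then show ?thesis by (simp add: ys)
  qed
  have "order_sign (B x @ ?c xs) (B x @ ?c us @ ?c vs) = 1"
    using Cons.prems(4) IH sc by (subst order_sign_append) (auto simp: order_sign_refl)
  moreover have "order_sign ((B x @ ?c us) @ ?c vs) ((?c us @ B x) @ ?c vs) = 1"
  proof -
    have "distinct (B x @ ?c us)" using dist by auto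
    then show ?thesis
      using dist Cons.prems(5)[of x]
      by (subst order_sign_append) (auto simp: order_sign_refl order_sign_swap)
  qed
  moreover have "order_sign (B x @ ?c xs) (B x @ ?c us @ ?c vs) * order_sign (B x @ ?c us @ ?c vs) (?c us @ B x @ ?c vs)
      = order_sign (B x @ ?c xs) (?c us @ B x @ ?c vs)"
    using Cons.prems(4) dist sc by (intro order_sign_trans) auto
  ultimately show ?case by (simp add: ys)
qed


section \<open>The sign of a family of directed circuits\<close>

text \<open>
  Reading a path as tails and heads of its edges, and dropping the first tail while adding the tail
  following the last head, pairs every head with the next tail.
\<close>

lemma rotate_half_edges:
  "concat (map (\<lambda>n. [t ((\<sigma> ^^ n) x), h ((\<sigma> ^^ n) x)]) [0..<m]) @ [t ((\<sigma> ^^ m) x)] =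
   t x # concat (map (\<lambda>n. [h ((\<sigma> ^^ n) x), t (\<sigma> ((\<sigma> ^^ n) x))]) [0..<m])"
  by (induction m) auto

text \<open>
  A closed path is the same word up to moving its first letter to the end, past an odd number of
  letters.
\<close>

lemma order_sign_circuit:
  assumes m: "0 < m" "(\<sigma> ^^ m) x = x"
    and dist: "distinct (concat (map (\<lambda>f. [t f, h f]) (map (\<lambda>n. (\<sigma> ^^ n) x) [0..<m])))"
  shows "order_sign (concat (map (\<lambda>f. [t f, h f]) (map (\<lambda>n. (\<sigma> ^^ n) x) [0..<m])))
           (concat (map (\<lambda>f. [h f, t (\<sigma> f)]) (map (\<lambda>n. (\<sigma> ^^ n) x) [0..<m]))) = - 1"
    and "set (concat (map (\<lambda>f. [h f, t (\<sigma> f)]) (map (\<lambda>n. (\<sigma> ^^ n) x) [0..<m]))) =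
      set (concat (map (\<lambda>f. [t f, h f]) (map (\<lambda>n. (\<sigma> ^^ n) x) [0..<m])))"
proof -
  let ?A = "concat (map (\<lambda>f. [t f, h f]) (map (\<lambda>n. (\<sigma> ^^ n) x) [0..<m]))"
  let ?B = "concat (map (\<lambda>f. [h f, t (\<sigma> f)]) (map (\<lambda>n. (\<sigma> ^^ n) x) [0..<m]))"
  have rot: "?A @ [t x] = t x # ?B"
    using rotate_half_edges[of t \<sigma> x h m] m(2) by (simp add: o_def)
  have "length ?A = 2 * m" by (simp add: length_concat o_def sum_list_triv)
  then obtain rest where A: "?A = t x # rest"
    using rot m(1) by (cases ?A) auto
  then have B: "?B = rest @ [t x]" using rot by simp
  have "length rest = 2 * m - 1" using \<open>length ?A = 2 * m\<close> A by simp
  then have "odd (length rest)" using m(1) by simp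
  moreover have "order_sign ([t x] @ rest) (rest @ [t x]) = (-1) ^ (length [t x] * length rest)"
    by (rule order_sign_swap) (use dist A in simp)
  ultimately show "order_sign ?A ?B = - 1" unfolding A B by simp
  show "set ?B = set ?A" unfolding A B by auto
qed

text \<open>
  Here \<open>t f\<close> and \<open>h f\<close> are the tail and the head of the edge \<open>f\<close> and \<open>\<sigma> f\<close> is the edge that follows
  it. The edges can be listed circuit by circuit on both sides, since pairs of letters form
  blocks of even length; then every circuit, that is, every orbit of \<open>\<sigma>\<close>, contributes \<open>-1\<close>.
\<close>

lemma order_sign_circuits:
  assumes \<sigma>: "\<sigma> permutes F" and fin: "finite F"
    and xs: "distinct xs" "set xs = F" and ys: "distinct ys" "set ys = F"
    and inj: "distinct (concat (map (\<lambda>f. [t f, h f]) xs))"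
  shows "order_sign (concat (map (\<lambda>f. [t f, h f]) xs)) (concat (map (\<lambda>f. [h f, t (\<sigma> f)]) ys)) =
    (-1) ^ card (orbit \<sigma> ` F)"
proof -
  let ?TH = "\<lambda>f. [t f, h f]" and ?HT = "\<lambda>f. [h f, t (\<sigma> f)]"
  have perm: "permutation \<sigma>" using \<sigma> fin by (auto simp: permutation_permutes)
  have self: "f \<in> orbit \<sigma> f" for f by (rule permutation_self_in_orbit[OF perm])
  obtain Cs where Cs: "distinct Cs" "set Cs = orbit \<sigma> ` F"
    using finite_distinct_list[of "orbit \<sigma> ` F"] fin by auto
  define r where "r C = (SOME f. f \<in> F \<and> orbit \<sigma> f = C)" for C
  have r: "r C \<in> F \<and> orbit \<sigma> (r C) = C" if "C \<in> set Cs" for C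
    unfolding r_def by (rule someI_ex) (use that Cs in auto)
  define m where "m C = funpow_dist1 \<sigma> (r C) (r C)" for C
  define cyc where "cyc C = map (\<lambda>n. (\<sigma> ^^ n) (r C)) [0..<m C]" for C
  have m: "0 < m C" "(\<sigma> ^^ m C) (r C) = r C" for C
    unfolding m_def using funpow_dist1_prop[OF self] by simp_all
  have cyc_set: "set (cyc C) = C" if "C \<in> set Cs" for C
    using orbit_conv_funpow_dist1[OF self[of "r C"]] r[OF that] by (simp only: cyc_def m_def set_map set_upt)
  have cyc_dist: "distinct (cyc C)" for C
    using inj_on_funpow_dist1[OF self, of "r C"] by (simp only: cyc_def m_def distinct_map set_upt distinct_upt simp_thms)
  \<comment> \<open>Both words are compared through the listing of \<open>F\<close> cycle by cycle.\<close>
  define zs where "zs = concat (map cyc Cs)"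
  have disj: "C \<inter> D = {}" if "C \<in> set Cs" "D \<in> set Cs" "C \<noteq> D" for C D
  proof (rule ccontr)
    assume "C \<inter> D \<noteq> {}"
    then obtain x where "x \<in> C" "x \<in> D" by blast
    then have x: "x \<in> orbit \<sigma> (r C)" "x \<in> orbit \<sigma> (r D)" using r that by simp_all
    have "orbit \<sigma> x = C" "orbit \<sigma> x = D"
      using orbit_cyclic_eq3[OF cyclic_on_orbit'[OF perm] x(1)]
        orbit_cyclic_eq3[OF cyclic_on_orbit'[OF perm] x(2)] r that by auto
    then show False using that by simp
  qed
  have zs: "distinct zs" "set zs = F"
  proof -
    show "distinct zs"
      unfolding zs_def distinct_concat_map[OF Cs(1)] using cyc_dist cyc_set disj by simp
    show "set zs = F"
    proof
      show "set zs \<subseteq> F"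
      proof
        fix x assume "x \<in> set zs"
        then obtain C where "C \<in> set Cs" "x \<in> set (cyc C)" by (auto simp: zs_def)
        then have "x \<in> orbit \<sigma> (r C)" "r C \<in> F" using cyc_set r by auto
        then show "x \<in> F" using permutes_orbit_subset[OF \<sigma>] by blast
      qed
      show "F \<subseteq> set zs"
      proof
        fix x assume "x \<in> F"
        then have "orbit \<sigma> x \<in> set Cs" using Cs(2) by blast
        then show "x \<in> set zs" using cyc_set self unfolding zs_def by auto
      qed
    qed
  qed
  have same: "set (concat (map ?HT us)) = set (concat (map ?TH us))" if "set us = F" for us
  proof -
    have "set (concat (map ?HT us)) = h ` F \<union> t ` \<sigma> ` F" using that by auto
    moreover have "set (concat (map ?TH us)) = h ` F \<union> t ` F" using that by auto
    ultimately show ?thesis by (simp only: permutes_image[OF \<sigma>])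
  qed
  have TH_eq: "set (concat (map ?TH us)) = t ` F \<union> h ` F" if "set us = F" for us
    using that by auto
  have inj': "inj_on t F" "inj_on h F" "t ` F \<inter> h ` F = {}"
  proof -
    have a: "t f \<noteq> h f" if "f \<in> F" for f
      using inj that unfolding distinct_concat_map[OF xs(1)] xs(2) by simp
    have b: "{t f, h f} \<inter> {t g, h g} = {}" if "f \<in> F" "g \<in> F" "f \<noteq> g" for f g
      using inj that unfolding distinct_concat_map[OF xs(1)] xs(2) by simp
    show "inj_on t F" "inj_on h F" by (rule inj_onI, use b in blast)+
    show "t ` F \<inter> h ` F = {}" using a b by blast
  qed
  have d1: "distinct (concat (map ?TH us))" if "distinct us" "set us = F" for us
    using inj unfolding distinct_concat_map[OF that(1)] that(2) distinct_concat_map[OF xs(1)] xs(2) .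
  have d2: "distinct (concat (map ?HT us))" if "distinct us" "set us = F" for us
    unfolding distinct_concat_map[OF that(1)] that(2)
  proof safe
    fix f assume f: "f \<in> F"
    then have "\<sigma> f \<in> F" using permutes_in_image[OF \<sigma>] by simp
    then show "distinct [h f, t (\<sigma> f)]" using f inj'(3) by auto
    fix g x assume g: "g \<in> F" and fg: "f \<noteq> g" and x: "x \<in> set [h f, t (\<sigma> f)]" "x \<in> set [h g, t (\<sigma> g)]"
    have "\<sigma> g \<in> F" "\<sigma> f \<noteq> \<sigma> g"
      using g fg permutes_in_image[OF \<sigma>] permutes_inj[OF \<sigma>] by (auto dest: injD)
    then have "h f \<noteq> h g" "t (\<sigma> f) \<noteq> t (\<sigma> g)"
      using inj_on_eq_iff[OF inj'(2) f g] inj_on_eq_iff[OF inj'(1) \<open>\<sigma> f \<in> F\<close>] fg by simp_all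
    moreover have "h f \<noteq> t (\<sigma> g)" "h g \<noteq> t (\<sigma> f)"
      using f g \<open>\<sigma> f \<in> F\<close> \<open>\<sigma> g \<in> F\<close> inj'(3) by blast+
    ultimately have "h f \<noteq> h g" "t (\<sigma> f) \<noteq> t (\<sigma> g)" "h f \<noteq> t (\<sigma> g)" "h g \<noteq> t (\<sigma> f)"
      by simp_all
    then show "x \<in> {}" using x by auto
  qed
  have TH: "concat (map ?TH zs) = concat (map (\<lambda>C. concat (map ?TH (cyc C))) Cs)"
    and HT: "concat (map ?HT zs) = concat (map (\<lambda>C. concat (map ?HT (cyc C))) Cs)"
    unfolding zs_def by (induction Cs) simp_all
  have dc: "distinct (concat (map ?TH (cyc C)))" if "C \<in> set Cs" for C
    using d1[OF zs] that unfolding TH distinct_concat_map[OF Cs(1)] by blast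
  have "order_sign (concat (map ?TH zs)) (concat (map ?HT zs)) =
      prod_list (map (\<lambda>C. order_sign (concat (map ?TH (cyc C))) (concat (map ?HT (cyc C)))) Cs)"
    unfolding TH HT
  proof (rule order_sign_concat)
    show "distinct (concat (map (\<lambda>C. concat (map ?TH (cyc C))) Cs))"
      using d1[OF zs] by (simp only: TH)
    show "set (concat (map ?TH (cyc C))) = set (concat (map ?HT (cyc C)))" if "C \<in> set Cs" for C
      using order_sign_circuit(2)[OF m dc[OF that, unfolded cyc_def]] by (simp only: cyc_def)
  qed
  also have "\<dots> = prod_list (map (\<lambda>C. - 1) Cs)"
  proof -
    have "map (\<lambda>C. order_sign (concat (map ?TH (cyc C))) (concat (map ?HT (cyc C)))) Cs = map (\<lambda>C. - 1) Cs"
    proof (rule map_cong[OF refl])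
      fix C assume "C \<in> set Cs"
      then show "order_sign (concat (map ?TH (cyc C))) (concat (map ?HT (cyc C))) = - 1"
        using order_sign_circuit(1)[OF m dc[unfolded cyc_def]] by (simp only: cyc_def)
    qed
    then show ?thesis by (simp only:)
  qed
  also have "prod_list (map (\<lambda>C. - 1) Cs) = (-1 :: complex) ^ length Cs"
    by (induction Cs) simp_all
  also have "length Cs = card (orbit \<sigma> ` F)"
    using distinct_card[OF Cs(1)] by (simp only: Cs(2))
  finally have mid: "order_sign (concat (map ?TH zs)) (concat (map ?HT zs)) = (-1) ^ card (orbit \<sigma> ` F)" .
  have "order_sign (concat (map ?TH xs)) (concat (map ?TH zs)) = 1"
    by (rule order_sign_even_blocks[OF xs(1) zs(1) _ inj]) (simp_all add: xs(2) zs(2))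
  moreover have "order_sign (concat (map ?HT zs)) (concat (map ?HT ys)) = 1"
    by (rule order_sign_even_blocks[OF zs(1) ys(1) _ d2[OF zs]]) (simp_all add: ys(2) zs(2))
  moreover have "order_sign (concat (map ?TH xs)) (concat (map ?TH zs)) *
      order_sign (concat (map ?TH zs)) (concat (map ?HT zs)) = order_sign (concat (map ?TH xs)) (concat (map ?HT zs))"
    by (rule order_sign_trans[OF d1[OF xs] d1[OF zs] d2[OF zs]])
      (simp_all only: same[OF zs(2)] TH_eq[OF xs(2)] TH_eq[OF zs(2)])
  moreover have "order_sign (concat (map ?TH xs)) (concat (map ?HT zs)) *
      order_sign (concat (map ?HT zs)) (concat (map ?HT ys)) = order_sign (concat (map ?TH xs)) (concat (map ?HT ys))"
    by (rule order_sign_trans[OF d1[OF xs] d2[OF zs] d2[OF ys]])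
      (simp_all only: same[OF zs(2)] same[OF ys(2)] TH_eq[OF xs(2)] TH_eq[OF zs(2)] TH_eq[OF ys(2)])
  ultimately show ?thesis using mid by simp
qed


section \<open>The Koszul action on words of homogeneous vectors\<close>

lemma rearrangement_nth:
  assumes "distinct ys" "set xs = set ys" "i < length xs"
  shows "rearrangement xs ys i < length ys" "ys ! rearrangement xs ys i = xs ! i"
proof -
  have "\<exists>!j. j < length ys \<and> ys ! j = xs ! i"
    using assms by (metis in_set_conv_nth nth_eq_iff_index_eq nth_mem)
  from theI'[OF this] show "rearrangement xs ys i < length ys" "ys ! rearrangement xs ys i = xs ! i"
    using assms(3) by (simp_all add: rearrangement_def)
qed

lemma rearrangement_permutes:
  assumes "distinct xs" "distinct ys" "set xs = set ys"
  shows "rearrangement xs ys permutes {..<length xs}"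
proof (rule bij_imp_permutes)
  have len: "length xs = length ys" using assms distinct_card by metis
  have inj: "inj_on (rearrangement xs ys) {..<length xs}"
    using rearrangement_nth(2)[OF assms(2,3)] assms(1)
    by (intro inj_onI) (metis lessThan_iff nth_eq_iff_index_eq)
  moreover have "rearrangement xs ys ` {..<length xs} \<subseteq> {..<length xs}"
    using rearrangement_nth(1)[OF assms(2,3)] len by auto
  ultimately show "bij_betw (rearrangement xs ys) {..<length xs} {..<length xs}"
    by (simp add: bij_betw_def endo_inj_surj)
qed (simp add: rearrangement_def)

lemma permute_list_rearrangement:
  assumes "distinct xs" "distinct ys" "set xs = set ys"
  shows "permute_list (inv (rearrangement xs ys)) (map X xs) = map X ys"
proof (rule nth_equalityI)
  have len: "length xs = length ys" using assms distinct_card by metis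
  then show "length (permute_list (inv (rearrangement xs ys)) (map X xs)) = length (map X ys)" by simp
  fix i assume "i < length (permute_list (inv (rearrangement xs ys)) (map X xs))"
  then have i: "i < length xs" by simp
  note p = rearrangement_permutes[OF assms]
  have j: "inv (rearrangement xs ys) i < length xs"
    using permutes_in_image[OF permutes_inv[OF p], of i] i by simp
  have "xs ! inv (rearrangement xs ys) i = ys ! i"
    using rearrangement_nth(2)[OF assms(2,3) j] permutes_inverses(1)[OF p] by simp
  then show "permute_list (inv (rearrangement xs ys)) (map X xs) ! i = map X ys ! i"
    using i j len by (simp add: permute_list_def)
qed

text \<open>
  Inversions among the odd positions are the pairs of odd entries whose order the rearrangement
  reverses.
\<close>

lemma koszul_sign_rearrangement:
  assumes "distinct xs" "distinct ys" "set xs = set ys"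
  shows "koszul_sign (rearrangement xs ys) (map P xs) = order_sign (filter P xs) (filter P ys)"
proof -
  let ?\<sigma> = "rearrangement xs ys"
  let ?S = "{(i, j). i < j \<and> j < length xs \<and> P (xs ! i) \<and> P (xs ! j) \<and> ?\<sigma> j < ?\<sigma> i}"
  let ?g = "\<lambda>(i, j). (xs ! i, xs ! j)"
  have len: "length xs = length ys" using assms distinct_card by metis
  have before_ys: "(xs ! j, xs ! i) \<in> before ys \<longleftrightarrow> ?\<sigma> j < ?\<sigma> i"
    if "i < length xs" "j < length xs" for i j
  proof
    assume "(xs ! j, xs ! i) \<in> before ys"
    then obtain m n where "xs ! j = ys ! m" "xs ! i = ys ! n" "m < n" "n < length ys"
      unfolding before_conv_nth by blast
    moreover have "ys ! ?\<sigma> j = xs ! j" "ys ! ?\<sigma> i = xs ! i" "?\<sigma> j < length ys" "?\<sigma> i < length ys"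
      using rearrangement_nth[OF assms(2,3)] that by auto
    ultimately have "?\<sigma> j = m" "?\<sigma> i = n" using assms(2) by (metis nth_eq_iff_index_eq order_less_trans)+
    then show "?\<sigma> j < ?\<sigma> i" using \<open>m < n\<close> by simp
  next
    assume "?\<sigma> j < ?\<sigma> i"
    then show "(xs ! j, xs ! i) \<in> before ys"
      unfolding before_conv_nth using rearrangement_nth[OF assms(2,3)] that by (smt (verit) mem_Collect_eq)
  qed
  have img: "?g ` ?S = before (filter P xs) \<inter> (before (filter P ys))\<inverse>"
  proof
    show "?g ` ?S \<subseteq> before (filter P xs) \<inter> (before (filter P ys))\<inverse>"
    proof
      fix p assume "p \<in> ?g ` ?S"
      then obtain i j where ij: "p = (xs ! i, xs ! j)" "i < j" "j < length xs" "P (xs ! i)" "P (xs ! j)" "?\<sigma> j < ?\<sigma> i"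
        by auto
      then have "(xs ! i, xs ! j) \<in> before xs" unfolding before_conv_nth by blast
      then show "p \<in> before (filter P xs) \<inter> (before (filter P ys))\<inverse>"
        using ij before_ys[of i j] by (simp add: before_filter)
    qed
    show "before (filter P xs) \<inter> (before (filter P ys))\<inverse> \<subseteq> ?g ` ?S"
    proof
      fix p assume p: "p \<in> before (filter P xs) \<inter> (before (filter P ys))\<inverse>"
      then have "p \<in> before xs" by (auto simp: before_filter)
      then obtain i j where ij: "p = ?g (i, j)" "i < j" "j < length xs"
        unfolding before_conv_nth by auto
      then have "(i, j) \<in> ?S" using p before_ys[of i j] by (simp add: before_filter)
      then show "p \<in> ?g ` ?S" using ij(1) by blast
    qed
  qed
  have inj: "inj_on ?g ?S"
  proof (rule inj_onI)
    fix p q assume pq: "p \<in> ?S" "q \<in> ?S" "?g p = ?g q"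
    obtain i j m n where ij: "p = (i, j)" "q = (m, n)" by force
    then have "i < length xs" "j < length xs" "m < length xs" "n < length xs" "xs ! i = xs ! m" "xs ! j = xs ! n"
      using pq by auto
    then show "p = q" unfolding ij using nth_eq_iff_index_eq[OF assms(1)] by blast
  qed
  have "card (before (filter P xs) \<inter> (before (filter P ys))\<inverse>) = card ?S"
    unfolding img[symmetric] by (rule card_image[OF inj])
  moreover have "{(i, j). i < j \<and> j < length (map P xs) \<and> map P xs ! i \<and> map P xs ! j \<and> ?\<sigma> j < ?\<sigma> i} = ?S"
    by auto
  ultimately show ?thesis unfolding koszul_sign_def order_sign_def by simp
qed

lemma part_component:
  assumes "x \<in> component q"
  shows "part p x = (if p = q then x else 0)"
proof (cases "p = q")
  case True
  then show ?thesis using assms component_zero by (intro part_eqI) auto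
next
  case False
  then have "q = (\<not> p)" by auto
  then show ?thesis using assms component_zero by (intro part_eqI) auto
qed

lemma tensor_word_zero: "0 \<in> set w \<Longrightarrow> tensor_word w = 0"
proof -
  assume "0 \<in> set w"
  then obtain u v where "w = u @ 0 # v" by (meson split_list)
  then show ?thesis using multilinear_scale[OF multilinear_tensor_word, of u 0 0 v] by simp
qed

text \<open>
  In the expansion into homogeneous components only the summand of the actual parities survives; the
  word of any other summand contains a zero vector.
\<close>

lemma koszul_act_homogeneous:
  assumes "distinct xs" "distinct ys" "set xs = set ys"
    and X: "\<And>a. a \<in> set xs \<Longrightarrow> X a \<in> component (P a)"
  shows "koszul_act (length xs) (rearrangement xs ys) (tensor_word (map X xs)) =
    order_sign (filter P xs) (filter P ys) *\<^sub>C tensor_word (map X ys)"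
proof -
  let ?d = "length xs" and ?\<sigma> = "rearrangement xs ys"
  note p = rearrangement_permutes[OF assms(1-3)]
  let ?t = "\<lambda>ps. koszul_sign ?\<sigma> ps *\<^sub>C tensor_word (permute_list (inv ?\<sigma>) (map2 part ps (map X xs)))"
  have zero: "?t ps = 0" if "length ps = ?d" "ps \<noteq> map P xs" for ps
  proof -
    have "\<exists>i<?d. ps ! i \<noteq> P (xs ! i)"
      using that by (auto simp: list_eq_iff_nth_eq)
    then obtain i where i: "i < ?d" "ps ! i \<noteq> P (xs ! i)" by blast
    have "X (xs ! i) \<in> component (P (xs ! i))" using X i(1) by simp
    then have "map2 part ps (map X xs) ! i = 0"
      using i that(1) by (simp add: part_component[of _ "P (xs ! i)"])
    moreover have "i < length (map2 part ps (map X xs))" using i(1) that(1) by simp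
    ultimately have "0 \<in> set (map2 part ps (map X xs))" by (metis nth_mem)
    moreover have "inv ?\<sigma> permutes {..<length (map2 part ps (map X xs))}"
      using permutes_inv[OF p] that(1) by simp
    ultimately show ?thesis by (subst tensor_word_zero) simp_all
  qed
  have "map2 part (map P xs) (map X xs) = map X xs"
  proof (rule nth_equalityI)
    fix i assume "i < length (map2 part (map P xs) (map X xs))"
    then show "map2 part (map P xs) (map X xs) ! i = map X xs ! i"
      using part_component[OF X, of "xs ! i"] by simp
  qed simp
  then have main: "?t (map P xs) = order_sign (filter P xs) (filter P ys) *\<^sub>C tensor_word (map X ys)"
    by (simp add: permute_list_rearrangement[OF assms(1-3)] koszul_sign_rearrangement[OF assms(1-3)])
  have "finite {ps :: bool list. length ps = ?d}"
    using finite_lists_length_eq[of "UNIV :: bool set" ?d] by simp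
  then have "(\<Sum>ps\<in>{ps. length ps = ?d}. ?t ps) = (\<Sum>ps\<in>{map P xs}. ?t ps)"
  proof (rule sum.mono_neutral_right)
    show "\<forall>ps\<in>{ps. length ps = ?d} - {map P xs}. ?t ps = 0"
      by (rule ballI, rule zero) simp_all
  qed simp
  then show ?thesis
    unfolding koszul_act_word[OF p] koszul_word_def using main by simp
qed

text \<open>
  The relation defining the coinvariants, for the permutation that rearranges \<open>xs\<close> into \<open>ys\<close>.
\<close>

lemma super_sym_proj_rearrange:
  assumes "distinct xs" "distinct ys" "set xs = set ys"
    and X: "\<And>a. a \<in> set xs \<Longrightarrow> X a \<in> component (P a)"
  shows "\<varpi> (tensor_word (map X xs)) = order_sign (filter P xs) (filter P ys) *\<^sub>C \<varpi> (tensor_word (map X ys))"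
proof -
  have "tensor_word (map X xs) \<in> tensor_power (length xs)"
    unfolding tensor_power_def by (rule cvec.span_base) auto
  then have "koszul_act (length xs) (rearrangement xs ys) (tensor_word (map X xs)) - tensor_word (map X xs)
      \<in> cvec.span sym_relations"
    using rearrangement_permutes[OF assms(1-3)]
    unfolding sym_relations_def by (intro cvec.span_base) blast
  then have "\<varpi> (koszul_act (length xs) (rearrangement xs ys) (tensor_word (map X xs))) = \<varpi> (tensor_word (map X xs))"
    by (simp add: super_sym.abs_eq_iff sym_eq_def)
  moreover have "koszul_act (length xs) (rearrangement xs ys) (tensor_word (map X xs)) =
      order_sign (filter P xs) (filter P ys) *\<^sub>C tensor_word (map X ys)"
    using assms by (rule koszul_act_homogeneous)
  ultimately show ?thesis by (simp add: scaleC_super_sym.abs_eq)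
qed


section \<open>Expanding products of tensors\<close>

lemma clinear_sum: "clinear f \<Longrightarrow> f (sum g A) = (\<Sum>x\<in>A. f (g x))"
proof -
  assume "clinear f"
  then interpret Vector_Spaces.linear scaleC scaleC f .
  show ?thesis by (rule sum)
qed

lemma clinear_functional_scale: "clinear f \<Longrightarrow> f (c *\<^sub>C x) = c * f x"
  unfolding clinear_iff by (simp add: scaleC_complex_def)

lemma multilinear_word_append: "multilinear (\<lambda>v. tensor_word (u @ v))"
  unfolding multilinear_def
proof (intro allI)
  fix u' v
  show "clinear (\<lambda>x. tensor_word (u @ u' @ x # v))"
    using multilinear_tensor_word[unfolded multilinear_def, rule_format, of "u @ u'" v] by simp
qed

text \<open>
  Linearity in one letter of \<open>u\<close> is an equality of linear maps in \<open>t\<close>, so it may be tested on words.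
\<close>

lemma multilinear_word_mult:
  "multilinear (\<lambda>u. tensor_lift (\<lambda>v. tensor_word (u @ v)) t)"
proof -
  define G where "G u = tensor_lift (\<lambda>v. tensor_word (u @ v))" for u :: "'a list"
  have G: "clinear (G u)" "G u (tensor_word w) = tensor_word (u @ w)" for u w
    unfolding G_def by (rule clinear_tensor_lift tensor_lift_word, rule multilinear_word_append)+
  have "multilinear (\<lambda>u. G u t)"
    unfolding multilinear_def clinear_iff
  proof safe
    fix u v :: "'a list" and x y c
    have "G (u @ (x + y) # v) = (\<lambda>t. G (u @ x # v) t + G (u @ y # v) t)"
    proof (rule tensor_lift_unique)
      show "clinear (\<lambda>t. G (u @ x # v) t + G (u @ y # v) t)"
        using G(1) by (simp add: clinear_iff scaleC_add_right)
    qed (simp_all add: G multilinear_add[OF multilinear_tensor_word])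
    then show "G (u @ (x + y) # v) t = G (u @ x # v) t + G (u @ y # v) t" by metis
    have "G (u @ (c *\<^sub>C x) # v) = (\<lambda>t. c *\<^sub>C G (u @ x # v) t)"
    proof (rule tensor_lift_unique)
      show "clinear (\<lambda>t. c *\<^sub>C G (u @ x # v) t)"
        using G(1) by (simp add: clinear_iff scaleC_add_right mult.commute)
    qed (simp_all add: G multilinear_scale[OF multilinear_tensor_word])
    then show "G (u @ (c *\<^sub>C x) # v) t = c *\<^sub>C G (u @ x # v) t" by metis
  qed
  then show ?thesis unfolding G_def .
qed

lemma clinear_tensor_mult_left: "clinear (\<lambda>s. s \<otimes> t)"
  unfolding tensor_mult_def by (rule clinear_tensor_lift[OF multilinear_word_mult])

lemma tensor_mult_add_left: "(s + s') \<otimes> t = s \<otimes> t + s' \<otimes> t"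
  and tensor_mult_scale_left: "(c *\<^sub>C s) \<otimes> t = c *\<^sub>C (s \<otimes> t)"
  using clinear_tensor_mult_left[of t] unfolding clinear_iff by auto

lemma clinear_tensor_mult_right: "clinear (\<lambda>t. s \<otimes> t)"
proof -
  have G: "clinear (tensor_lift (\<lambda>v. tensor_word (u @ v)))" for u :: "'a list"
    by (rule clinear_tensor_lift[OF multilinear_word_append])
  have word: "tensor_word u \<otimes> t = tensor_lift (\<lambda>v. tensor_word (u @ v)) t" for u :: "'a list" and t
    unfolding tensor_mult_def by (rule tensor_lift_word[OF multilinear_word_mult])
  show ?thesis
    unfolding clinear_iff
  proof (intro conjI allI)
    fix t t' :: "'a tensor" and c
    have "(\<lambda>s. s \<otimes> (t + t')) = (\<lambda>s. s \<otimes> t + s \<otimes> t')"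
    proof (rule tensor_lift_unique)
      show "clinear (\<lambda>s. s \<otimes> t + s \<otimes> t')"
        by (simp add: clinear_iff scaleC_add_right tensor_mult_add_left tensor_mult_scale_left)
      show "tensor_word w \<otimes> (t + t') = tensor_word w \<otimes> t + tensor_word w \<otimes> t'" for w
        using G[of w] by (simp add: word clinear_iff)
    qed (rule clinear_tensor_mult_left)
    then show "s \<otimes> (t + t') = s \<otimes> t + s \<otimes> t'" by metis
    have "(\<lambda>s. s \<otimes> (c *\<^sub>C t)) = (\<lambda>s. c *\<^sub>C (s \<otimes> t))"
    proof (rule tensor_lift_unique)
      show "clinear (\<lambda>s. c *\<^sub>C (s \<otimes> t))"
        by (simp add: clinear_iff scaleC_add_right mult.commute tensor_mult_add_left tensor_mult_scale_left)
      show "tensor_word w \<otimes> (c *\<^sub>C t) = c *\<^sub>C (tensor_word w \<otimes> t)" for w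
        using G[of w] by (simp add: word clinear_iff)
    qed (rule clinear_tensor_mult_left)
    then show "s \<otimes> (c *\<^sub>C t) = c *\<^sub>C (s \<otimes> t)" by metis
  qed
qed

lemma tensor_prod_list_Cons: "tensor_prod_list (t # ts) = t \<otimes> tensor_prod_list ts"
  by (simp add: tensor_prod_list_def)

lemma tensor_prod_list_add:
  assumes "distinct es"
  shows "tensor_prod_list (map (\<lambda>f. A f + B f) es) =
    (\<Sum>F\<in>Pow (set es). tensor_prod_list (map (\<lambda>f. if f \<in> F then B f else A f) es))"
  using assms
proof (induction es)
  case Nil
  then show ?case by simp
next
  case (Cons f es)
  let ?P = "\<lambda>F. tensor_prod_list (map (\<lambda>f. if f \<in> F then B f else A f) es)"
  have nf: "f \<notin> F" if "F \<in> Pow (set es)" for F using that Cons.prems by auto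
  have "tensor_prod_list (map (\<lambda>f. A f + B f) (f # es)) = (A f + B f) \<otimes> (\<Sum>F\<in>Pow (set es). ?P F)"
    using Cons by (simp add: tensor_prod_list_Cons)
  also have "\<dots> = (\<Sum>F\<in>Pow (set es). A f \<otimes> ?P F) + (\<Sum>F\<in>Pow (set es). B f \<otimes> ?P F)"
    by (simp add: clinear_sum[OF clinear_tensor_mult_right] tensor_mult_add_left sum.distrib)
  also have "(\<Sum>F\<in>Pow (set es). A f \<otimes> ?P F) =
      (\<Sum>F\<in>Pow (set es). tensor_prod_list (map (\<lambda>f. if f \<in> F then B f else A f) (f # es)))"
    by (rule sum.cong) (simp_all add: tensor_prod_list_Cons nf)
  also have "(\<Sum>F\<in>Pow (set es). B f \<otimes> ?P F) =
      (\<Sum>F\<in>insert f ` Pow (set es). tensor_prod_list (map (\<lambda>f. if f \<in> F then B f else A f) (f # es)))"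
  proof (subst sum.reindex)
    show "inj_on (insert f) (Pow (set es))" using nf by (intro inj_onI) (metis insert_ident)
    show "(\<Sum>F\<in>Pow (set es). B f \<otimes> ?P F) =
      sum ((\<lambda>F. tensor_prod_list (map (\<lambda>f. if f \<in> F then B f else A f) (f # es))) \<circ> insert f) (Pow (set es))"
    proof (rule sum.cong[OF refl])
      fix F assume "F \<in> Pow (set es)"
      have "map (\<lambda>g. if g \<in> insert f F then B g else A g) es = map (\<lambda>g. if g \<in> F then B g else A g) es"
        by (rule map_cong) (use Cons.prems in auto)
      then show "B f \<otimes> ?P F = ((\<lambda>F. tensor_prod_list (map (\<lambda>f. if f \<in> F then B f else A f) (f # es))) \<circ> insert f) F"
        by (simp only: list.map o_apply tensor_prod_list_Cons insertI1 if_True)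
    qed
  qed
  finally show ?case
    using nf by (simp add: Pow_insert, subst sum.union_disjoint) auto
qed

lemma tensor_prod_list_sum:
  assumes "distinct es"
  shows "tensor_prod_list (map (\<lambda>f. \<Sum>i\<in>I f. T f i) es) =
    (\<Sum>c\<in>PiE (set es) I. tensor_prod_list (map (\<lambda>f. T f (c f)) es))"
  using assms
proof (induction es)
  case Nil
  then show ?case by simp
next
  case (Cons f es)
  let ?P = "\<lambda>c. tensor_prod_list (map (\<lambda>f. T f (c f)) es)"
  have f: "f \<notin> set es" using Cons.prems by simp
  have "tensor_prod_list (map (\<lambda>f. \<Sum>i\<in>I f. T f i) (f # es)) = (\<Sum>i\<in>I f. T f i) \<otimes> (\<Sum>c\<in>PiE (set es) I. ?P c)"
    using Cons by (simp add: tensor_prod_list_Cons)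
  also have "\<dots> = (\<Sum>i\<in>I f. \<Sum>c\<in>PiE (set es) I. T f i \<otimes> ?P c)"
    by (simp only: clinear_sum[OF clinear_tensor_mult_right] clinear_sum[OF clinear_tensor_mult_left])
      (rule sum.swap)
  also have "\<dots> = (\<Sum>(i, c)\<in>I f \<times> PiE (set es) I. T f i \<otimes> ?P c)"
    by (rule sum.cartesian_product)
  also have "\<dots> = (\<Sum>c\<in>PiE (set (f # es)) I. tensor_prod_list (map (\<lambda>f. T f (c f)) (f # es)))"
  proof -
    have "map (\<lambda>g. T g ((c(f := i)) g)) es = map (\<lambda>g. T g (c g)) es" for c i
      by (rule map_cong) (use f in auto)
    then show ?thesis
      unfolding list.set PiE_insert_eq sum.reindex[OF inj_combinator[OF f]]
      by (intro sum.cong refl) (simp only: o_apply case_prod_unfold list.map tensor_prod_list_Cons fun_upd_same)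
  qed
  finally show ?case .
qed

lemma tensor_prod_list_words:
  "tensor_prod_list (map (\<lambda>f. q f *\<^sub>C tensor_word (w f)) es) =
     prod_list (map q es) *\<^sub>C tensor_word (concat (map w es))"
proof (induction es)
  case Nil
  then show ?case by (simp add: tensor_prod_list_def)
next
  case (Cons f es)
  have "tensor_prod_list (map (\<lambda>f. q f *\<^sub>C tensor_word (w f)) (f # es)) =
      (q f *\<^sub>C tensor_word (w f)) \<otimes> (prod_list (map q es) *\<^sub>C tensor_word (concat (map w es)))"
    by (simp add: tensor_prod_list_Cons Cons.IH)
  also have "\<dots> = q f *\<^sub>C prod_list (map q es) *\<^sub>C (tensor_word (w f) \<otimes> tensor_word (concat (map w es)))"
    using clinear_tensor_mult_left[unfolded clinear_iff] clinear_tensor_mult_right[unfolded clinear_iff] by metis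
  finally show ?case by (simp add: tensor_mult_word)
qed


section \<open>Circuits of a local pairing\<close>

lemma enum_list: "finite A \<Longrightarrow> distinct (enum_list A) \<and> set (enum_list A) = A"
  unfolding enum_list_def by (rule someI_ex) (metis finite_distinct_list)

text \<open>
  On a finite set the forward orbit of a permutation is the whole cycle, so reachability along the
  graph of the permutation describes its cycles.
\<close>

lemma rtrancl_graph_eq_orbit:
  assumes \<sigma>: "\<sigma> permutes F" and "finite F" "f \<in> F"
  shows "{(f, \<sigma> f) | f. f \<in> F}\<^sup>* `` {f} = orbit \<sigma> f" (is "?R\<^sup>* `` _ = _")
proof -
  have self: "f \<in> orbit \<sigma> f"
    using assms by (intro permutation_self_in_orbit) (auto simp: permutation_permutes)
  have fwd: "g \<in> orbit \<sigma> f" if "(f, g) \<in> ?R\<^sup>*" for g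
    using that
  proof induction
    case base
    show ?case by (rule self)
  next
    case (step y z)
    then have "z = \<sigma> y" by blast
    then show ?case using step.IH orbit.step by metis
  qed
  have bwd: "(f, g) \<in> ?R\<^sup>* \<and> g \<in> F" if "g \<in> orbit \<sigma> f" for g
    using that
  proof induction
    case base
    have "(f, \<sigma> f) \<in> ?R" using \<open>f \<in> F\<close> by blast
    then show ?case using \<open>f \<in> F\<close> permutes_in_image[OF \<sigma>, of f] by blast
  next
    case (step y)
    then have "(y, \<sigma> y) \<in> ?R" by blast
    then show ?case using step.IH permutes_in_image[OF \<sigma>, of y] by (meson rtrancl.rtrancl_into_rtrancl)
  qed
  show ?thesis using fwd bwd by blast
qed

lemma pairing_list:
  assumes fin: "finite F" and pair: "local_pairing G F \<omega> \<kappa>" and v: "v \<in> verts G"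
  shows "distinct (enum_list (\<kappa> v))" "set (enum_list (\<kappa> v)) = \<kappa> v"
    and "distinct (concat (map (\<lambda>(a, b). [a, b]) (enum_list (\<kappa> v))))"
    and "set (concat (map (\<lambda>(a, b). [a, b]) (enum_list (\<kappa> v)))) = half_edges_at G F v"
proof -
  have bij: "bij_betw fst (\<kappa> v) (incoming G F \<omega> v)" "bij_betw snd (\<kappa> v) (outgoing G F \<omega> v)"
    using pair v unfolding local_pairing_def by auto
  have finin: "finite (incoming G F \<omega> v)"
    by (rule finite_subset[of _ "F \<times> UNIV"]) (auto simp: incoming_def half_edges_at_def fin)
  show en: "distinct (enum_list (\<kappa> v))" "set (enum_list (\<kappa> v)) = \<kappa> v"
    using enum_list[of "\<kappa> v"] bij_betw_finite[OF bij(1)] finin by auto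
  have img: "fst ` \<kappa> v = incoming G F \<omega> v" "snd ` \<kappa> v = outgoing G F \<omega> v"
    and inj: "inj_on fst (\<kappa> v)" "inj_on snd (\<kappa> v)"
    using bij by (simp_all add: bij_betw_def)
  have disj: "fst ` \<kappa> v \<inter> snd ` \<kappa> v = {}"
    unfolding img by (auto simp: incoming_def outgoing_def)
  show "distinct (concat (map (\<lambda>(a, b). [a, b]) (enum_list (\<kappa> v))))"
    unfolding distinct_concat_map[OF en(1)] en(2)
  proof (intro conjI ballI impI)
    fix p assume p: "p \<in> \<kappa> v"
    have "fst p \<noteq> snd p" using disj p by blast
    then show "distinct (case p of (a, b) \<Rightarrow> [a, b])" by (simp add: case_prod_unfold)
    fix q assume q: "q \<in> \<kappa> v" "p \<noteq> q"
    have "fst p \<noteq> fst q" "snd p \<noteq> snd q"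
      using inj_on_eq_iff[OF inj(1) p q(1)] inj_on_eq_iff[OF inj(2) p q(1)] q(2) by simp_all
    moreover have "fst p \<noteq> snd q" "fst q \<noteq> snd p" using disj p q by blast+
    ultimately show "set (case p of (a, b) \<Rightarrow> [a, b]) \<inter> set (case q of (a, b) \<Rightarrow> [a, b]) = {}"
      by (auto simp: case_prod_unfold)
  qed
  have "set (concat (map (\<lambda>(a, b). [a, b]) (enum_list (\<kappa> v)))) = fst ` \<kappa> v \<union> snd ` \<kappa> v"
    by (force simp: en(2) case_prod_unfold)
  also have "\<dots> = half_edges_at G F v"
    unfolding img by (auto simp: incoming_def outgoing_def)
  finally show "set (concat (map (\<lambda>(a, b). [a, b]) (enum_list (\<kappa> v)))) = half_edges_at G F v" .
qed

text \<open>
  Every edge of \<open>F\<close> has one head and one tail, each lying in exactly one pair. Hence the pairs, listed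
  vertex by vertex, are indexed by the edges of their heads and define the permutation \<open>\<sigma>\<close> sending an
  edge to its successor, whose cycles are the directed circuits.
\<close>

lemma pairing_circuits:
  assumes fin: "finite F" and ends: "\<And>f t. f \<in> F \<Longrightarrow> ends G f t \<in> verts G"
    and vs: "distinct vs" "set vs = verts G"
    and pair: "local_pairing G F \<omega> \<kappa>"
  obtains \<sigma> ys where "\<sigma> permutes F" "distinct ys" "set ys = F"
    "concat (map (\<lambda>v. concat (map (\<lambda>(a, b). [a, b]) (enum_list (\<kappa> v)))) vs) =
      concat (map (\<lambda>f. [(f, \<not> \<omega> f), (\<sigma> f, \<omega> (\<sigma> f))]) ys)"
    "circuit_count G F \<kappa> = card (orbit \<sigma> ` F)"
proof -
  define PL where "PL = concat (map (\<lambda>v. enum_list (\<kappa> v)) vs)"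
  have bij: "bij_betw fst (\<kappa> v) (incoming G F \<omega> v)" "bij_betw snd (\<kappa> v) (outgoing G F \<omega> v)"
    if "v \<in> set vs" for v
    using pair that vs unfolding local_pairing_def by auto
  have en: "distinct (enum_list (\<kappa> v))" "set (enum_list (\<kappa> v)) = \<kappa> v" if "v \<in> set vs" for v
    using pairing_list(1,2)[OF fin pair] that vs by auto
  have inc: "a \<in> incoming G F \<omega> v \<longleftrightarrow> fst a \<in> F \<and> snd a = (\<not> \<omega> (fst a)) \<and> ends G (fst a) (snd a) = v" for a v
    by (cases a) (auto simp: incoming_def half_edges_at_def)
  have out: "a \<in> outgoing G F \<omega> v \<longleftrightarrow> fst a \<in> F \<and> snd a = \<omega> (fst a) \<and> ends G (fst a) (snd a) = v" for a v
    by (cases a) (auto simp: outgoing_def half_edges_at_def)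
  have img: "fst ` \<kappa> v = incoming G F \<omega> v" "snd ` \<kappa> v = outgoing G F \<omega> v" if "v \<in> set vs" for v
    using bij[OF that] by (simp_all add: bij_betw_def)
  have set_PL: "set PL = (\<Union>v\<in>set vs. \<kappa> v)"
    using en by (simp add: PL_def)
  have inPL: "fst (fst p) \<in> F \<and> snd (fst p) = (\<not> \<omega> (fst (fst p))) \<and> fst (snd p) \<in> F \<and> snd (snd p) = \<omega> (fst (snd p))"
    if p: "p \<in> set PL" for p
  proof -
    obtain v where v: "v \<in> set vs" "p \<in> \<kappa> v" using p set_PL by auto
    have "fst p \<in> incoming G F \<omega> v" "snd p \<in> outgoing G F \<omega> v"
      unfolding img[OF v(1), symmetric] using v(2) by (rule imageI)+
    then show ?thesis unfolding inc out by simp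
  qed
  have map_PL: "map fst PL = concat (map (\<lambda>v. map fst (enum_list (\<kappa> v))) vs)"
    "map snd PL = concat (map (\<lambda>v. map snd (enum_list (\<kappa> v))) vs)"
    by (simp_all add: PL_def map_concat o_def)
  have d1: "distinct (map fst PL)"
    unfolding map_PL distinct_concat_map[OF vs(1)]
  proof (intro conjI ballI impI)
    fix v assume v: "v \<in> set vs"
    show "distinct (map fst (enum_list (\<kappa> v)))"
      using en[OF v] bij(1)[OF v] by (simp add: distinct_map bij_betw_def)
    fix w assume w: "w \<in> set vs" "v \<noteq> w"
    show "set (map fst (enum_list (\<kappa> v))) \<inter> set (map fst (enum_list (\<kappa> w))) = {}"
      unfolding set_map en[OF v] en[OF w(1)] img[OF v] img[OF w(1)]
      using w(2) by (simp add: disjoint_iff inc)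
  qed
  have d2: "distinct (map snd PL)"
    unfolding map_PL distinct_concat_map[OF vs(1)]
  proof (intro conjI ballI impI)
    fix v assume v: "v \<in> set vs"
    show "distinct (map snd (enum_list (\<kappa> v)))"
      using en[OF v] bij(2)[OF v] by (simp add: distinct_map bij_betw_def)
    fix w assume w: "w \<in> set vs" "v \<noteq> w"
    show "set (map snd (enum_list (\<kappa> v))) \<inter> set (map snd (enum_list (\<kappa> w))) = {}"
      unfolding set_map en[OF v] en[OF w(1)] img[OF v] img[OF w(1)]
      using w(2) by (simp add: disjoint_iff out)
  qed
  define ys where "ys = map fst (map fst PL)"
  define zs where "zs = map fst (map snd PL)"
  have fst_PL: "snd a = (\<not> \<omega> (fst a))" if "a \<in> set (map fst PL)" for a
    using that inPL unfolding set_map by blast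
  have snd_PL: "snd a = \<omega> (fst a)" if "a \<in> set (map snd PL)" for a
    using that inPL unfolding set_map by blast
  have ys: "distinct ys"
    unfolding ys_def
  proof (rule distinct_map[THEN iffD2], rule conjI[OF d1], rule inj_onI)
    fix a b assume "a \<in> set (map fst PL)" "b \<in> set (map fst PL)" "fst a = fst b"
    then show "a = b" using fst_PL[of a] fst_PL[of b] by (simp only: prod_eq_iff simp_thms)
  qed
  have zs: "distinct zs"
    unfolding zs_def
  proof (rule distinct_map[THEN iffD2], rule conjI[OF d2], rule inj_onI)
    fix a b assume "a \<in> set (map snd PL)" "b \<in> set (map snd PL)" "fst a = fst b"
    then show "a = b" using snd_PL[of a] snd_PL[of b] by (simp only: prod_eq_iff simp_thms)
  qed
  have set_ys: "set ys = F"
  proof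
    show "set ys \<subseteq> F" using inPL by (auto simp: ys_def)
    show "F \<subseteq> set ys"
    proof
      fix f assume f: "f \<in> F"
      let ?v = "ends G f (\<not> \<omega> f)"
      have v: "?v \<in> set vs" using ends f vs by simp
      have "(f, \<not> \<omega> f) \<in> fst ` \<kappa> ?v" unfolding img(1)[OF v] inc using f by simp
      then obtain p where "p \<in> \<kappa> ?v" "fst p = (f, \<not> \<omega> f)" by auto
      then have "p \<in> set PL" "fst (fst p) = f" using set_PL v by auto
      then show "f \<in> set ys" by (force simp: ys_def)
    qed
  qed
  have len: "length ys = length zs" by (simp add: ys_def zs_def)
  have set_zs: "set zs = F"
  proof (rule card_subset_eq[OF fin])
    show "set zs \<subseteq> F" using inPL by (auto simp: zs_def)
    show "card (set zs) = card F"
      using distinct_card[OF ys] distinct_card[OF zs] len set_ys by simp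
  qed
  define \<sigma> where "\<sigma> f = (if f \<in> F then the (map_of (zip ys zs) f) else f)" for f
  have \<sigma>_nth: "\<sigma> (ys ! i) = zs ! i" if "i < length ys" for i
    using map_of_zip_nth[OF len ys, of i] that len nth_mem[OF that] set_ys by (simp add: \<sigma>_def)
  have "map \<sigma> ys = zs" by (rule nth_equalityI) (use len \<sigma>_nth in auto)
  then have surj: "\<sigma> ` F = F" using set_ys set_zs by (metis set_map)
  have perm: "\<sigma> permutes F"
  proof (rule bij_imp_permutes)
    show "bij_betw \<sigma> F F"
      using surj finite_surj_inj[OF fin, of \<sigma>] by (simp add: bij_betw_def)
  qed (simp add: \<sigma>_def)
  have \<sigma>_PL: "fst (snd p) = \<sigma> (fst (fst p))" if p: "p \<in> set PL" for p
  proof -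
    obtain i where "i < length PL" "p = PL ! i" using p by (metis in_set_conv_nth)
    then show ?thesis using \<sigma>_nth[of i] by (simp add: ys_def zs_def)
  qed
  have "concat (map (\<lambda>v. concat (map (\<lambda>(a, b). [a, b]) (enum_list (\<kappa> v)))) vs) =
      concat (map (\<lambda>(a, b). [a, b]) PL)"
    unfolding PL_def by (induction vs) simp_all
  also have "map (\<lambda>(a, b). [a, b]) PL = map (\<lambda>p. [(fst (fst p), \<not> \<omega> (fst (fst p))), (\<sigma> (fst (fst p)), \<omega> (\<sigma> (fst (fst p))))]) PL"
  proof (rule map_cong[OF refl])
    fix p assume p: "p \<in> set PL"
    show "(case p of (a, b) \<Rightarrow> [a, b]) = [(fst (fst p), \<not> \<omega> (fst (fst p))), (\<sigma> (fst (fst p)), \<omega> (\<sigma> (fst (fst p))))]"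
      using inPL[OF p] \<sigma>_PL[OF p] by (simp add: case_prod_unfold prod_eq_iff)
  qed
  finally have lists: "concat (map (\<lambda>v. concat (map (\<lambda>(a, b). [a, b]) (enum_list (\<kappa> v)))) vs) =
      concat (map (\<lambda>f. [(f, \<not> \<omega> f), (\<sigma> f, \<omega> (\<sigma> f))]) ys)"
    by (simp add: ys_def o_def)
  have "edge_successor G \<kappa> = (\<lambda>p. (fst (fst p), fst (snd p))) ` set PL"
    unfolding edge_successor_def set_PL vs(2) by force
  also have "\<dots> = (\<lambda>p. (fst (fst p), \<sigma> (fst (fst p)))) ` set PL"
    by (rule image_cong) (simp_all add: \<sigma>_PL)
  also have "\<dots> = (\<lambda>f. (f, \<sigma> f)) ` set ys"
    by (simp add: ys_def image_image)
  also have "\<dots> = {(f, \<sigma> f) | f. f \<in> F}" unfolding set_ys by blast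
  finally have succ: "edge_successor G \<kappa> = {(f, \<sigma> f) | f. f \<in> F}" .
  have "circuit_count G F \<kappa> = card (orbit \<sigma> ` F)"
    unfolding circuit_count_def succ
    by (rule arg_cong[of _ _ card], rule image_cong[OF refl], rule rtrancl_graph_eq_orbit[OF perm fin])
  then show thesis using that perm ys set_ys lists by blast
qed

lemma pairing_sign:
  assumes fin: "finite F" and ends: "\<And>f t. f \<in> F \<Longrightarrow> ends G f t \<in> verts G"
    and vs: "distinct vs" "set vs = verts G"
    and pair: "local_pairing G F \<omega> \<kappa>"
    and fs: "distinct fs" "set fs = F"
  shows "order_sign (concat (map (\<lambda>f. [(f, \<omega> f), (f, \<not> \<omega> f)]) fs))
      (concat (map (\<lambda>v. concat (map (\<lambda>(a, b). [a, b]) (enum_list (\<kappa> v)))) vs)) =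
    (-1) ^ circuit_count G F \<kappa>"
proof -
  obtain \<sigma> ys where \<sigma>: "\<sigma> permutes F" and ys: "distinct ys" "set ys = F"
    and lists: "concat (map (\<lambda>v. concat (map (\<lambda>(a, b). [a, b]) (enum_list (\<kappa> v)))) vs) =
      concat (map (\<lambda>f. [(f, \<not> \<omega> f), (\<sigma> f, \<omega> (\<sigma> f))]) ys)"
    and count: "circuit_count G F \<kappa> = card (orbit \<sigma> ` F)"
    by (rule pairing_circuits[OF fin ends vs pair])
  have "distinct (concat (map (\<lambda>f. [(f, \<omega> f), (f, \<not> \<omega> f)]) fs))"
    unfolding distinct_concat_map[OF fs(1)] by auto
  then show ?thesis
    unfolding lists count
    by (rule order_sign_circuits[OF \<sigma> fin fs ys, where t = "\<lambda>f. (f, \<omega> f)" and h = "\<lambda>f. (f, \<not> \<omega> f)"])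
qed


section \<open>Powers of the twisted element\<close>

text \<open>
  The vector placed at a half-edge: \<open>\<eta>\<close> on the outgoing and \<open>\<xi>\<close> on the incoming half-edges of \<open>F\<close>, an
  even basis vector on all others.
\<close>

definition half_edge_vector ::
    "(nat \<Rightarrow> 'a::complex_vec) \<Rightarrow> nat \<Rightarrow> (nat \<Rightarrow> 'a) \<Rightarrow> 'e set \<Rightarrow> ('e \<Rightarrow> bool) \<Rightarrow>
     ('e \<Rightarrow> nat) \<Rightarrow> ('e \<Rightarrow> nat) \<Rightarrow> 'e half_edge \<Rightarrow> 'a" where
  "half_edge_vector e l \<xi> F \<omega> \<psi> \<phi> = (\<lambda>(f, t).
     if f \<in> F then (if t = \<omega> f then eta l \<xi> (\<phi> f) else \<xi> (\<phi> f)) else e (\<psi> f))"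

lemma half_edge_vector_component:
  fixes e \<xi> :: "nat \<Rightarrow> 'a::super_vec"
  assumes "adapted_coordinates b k e l \<xi>"
    and "\<psi> \<in> (E - F) \<rightarrow>\<^sub>E {1..k}" "\<phi> \<in> F \<rightarrow>\<^sub>E {1..2 * l}" "fst a \<in> E"
  shows "half_edge_vector e l \<xi> F \<omega> \<psi> \<phi> a \<in> component (fst a \<in> F)"
proof -
  obtain f t where a: "a = (f, t)" by force
  have e: "e i \<in> component False" if "i \<in> {1..k}" for i
    using assms(1) that cvec.span_base[of "e i" "e ` {1..k}"] unfolding adapted_coordinates_def basis_family_def by blast
  have \<xi>: "\<xi> i \<in> component True" if "i \<in> {1..2 * l}" for i
    using assms(1) that cvec.span_base[of "\<xi> i" "\<xi> ` {1..2 * l}"] unfolding adapted_coordinates_def basis_family_def by blast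
  have \<eta>: "eta l \<xi> i \<in> component True" if "i \<in> {1..2 * l}" for i
  proof (cases "i \<le> l")
    case True
    then have "i + l \<in> {1..2 * l}" using that by auto
    from component_scale[OF \<xi>[OF this], of "-1"] show ?thesis using True by (simp add: eta_def)
  next
    case False
    then have "i - l \<in> {1..2 * l}" using that by auto
    from \<xi>[OF this] show ?thesis using False by (simp add: eta_def)
  qed
  show ?thesis
  proof (cases "f \<in> F")
    case True
    then have "\<phi> f \<in> {1..2 * l}" using assms(3) by blast
    then show ?thesis using \<xi> \<eta> True by (simp add: half_edge_vector_def a)
  next
    case False
    then have "\<psi> f \<in> {1..k}" using assms(2,4) a by auto
    then show ?thesis using e False by (simp add: half_edge_vector_def a)
  qed
qed

text \<open>
  Exchanging the colours \<open>i\<close> and \<open>i + l\<close> turns \<open>\<eta>\<^sub>i \<otimes> \<xi>\<^sub>i\<close> into \<open>- \<xi>\<^sub>i \<otimes> \<eta>\<^sub>i\<close>. This is the super symmetry of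
  the odd part of the twisted element; it makes the orientation of an edge a matter of choice.
\<close>

lemma twisted_element_odd_flip:
  "(\<Sum>i\<in>{1..2 * l}. tensor_word [eta l \<xi> i, \<xi> i]) = - (\<Sum>i\<in>{1..2 * l}. tensor_word [\<xi> i, eta l \<xi> i])"
proof -
  have neg: "tensor_word [- x, y] = - tensor_word [x, y]" "tensor_word [x, - y] = - tensor_word [x, y]" for x y :: 'a
    using multilinear_scale[OF multilinear_tensor_word, of "[]" "-1" x "[y]"]
      multilinear_scale[OF multilinear_tensor_word, of "[x]" "-1" y "[]"] by simp_all
  \<comment> \<open>The involution pairing the indices of dual odd basis vectors.\<close>
  define \<tau> where "\<tau> i = (if i \<le> l then i + l else i - l)" for i
  have "(\<Sum>i\<in>{1..2 * l}. tensor_word [eta l \<xi> i, \<xi> i]) = (\<Sum>i\<in>{1..2 * l}. - tensor_word [\<xi> i, eta l \<xi> i])"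
    by (rule sum.reindex_bij_witness[of _ \<tau> \<tau>]) (auto simp: \<tau>_def eta_def neg)
  then show ?thesis by (simp add: sum_negf)
qed

lemma sum_PiE_merge:
  assumes "F \<subseteq> E"
  shows "(\<Sum>c\<in>PiE E (\<lambda>f. if f \<in> F then B else A). g c) =
    (\<Sum>\<psi>\<in>(E - F) \<rightarrow>\<^sub>E A. \<Sum>\<phi>\<in>F \<rightarrow>\<^sub>E B. g (\<lambda>f. if f \<in> F then \<phi> f else \<psi> f))"
  unfolding sum.cartesian_product
proof (rule sum.reindex_bij_witness[of _ "\<lambda>(\<psi>, \<phi>) f. if f \<in> F then \<phi> f else \<psi> f"
      "\<lambda>c. (restrict c (E - F), restrict c F)"])
  fix c assume c: "c \<in> PiE E (\<lambda>f. if f \<in> F then B else A)"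
  have cf: "c f \<in> (if f \<in> F then B else A)" if "f \<in> E" for f
    using PiE_mem[OF c that] .
  have "(\<lambda>f. if f \<in> F then restrict c F f else restrict c (E - F) f) = c"
    using assms PiE_arb[OF c] by (auto simp: fun_eq_iff)
  then show "(case (restrict c (E - F), restrict c F) of (\<psi>, \<phi>) \<Rightarrow> \<lambda>f. if f \<in> F then \<phi> f else \<psi> f) = c"
    "(case (restrict c (E - F), restrict c F) of (\<psi>, \<phi>) \<Rightarrow> g (\<lambda>f. if f \<in> F then \<phi> f else \<psi> f)) = g c"
    by simp_all
  have "c f \<in> B" if "f \<in> F" for f using cf[of f] that assms by auto
  moreover have "c f \<in> A" if "f \<in> E - F" for f using cf[of f] that by auto
  ultimately show "(restrict c (E - F), restrict c F) \<in> ((E - F) \<rightarrow>\<^sub>E A) \<times> (F \<rightarrow>\<^sub>E B)" by auto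
next
  fix p assume p: "p \<in> ((E - F) \<rightarrow>\<^sub>E A) \<times> (F \<rightarrow>\<^sub>E B)"
  obtain \<psi> \<phi> where [simp]: "p = (\<psi>, \<phi>)" by force
  have \<psi>: "\<psi> \<in> (E - F) \<rightarrow>\<^sub>E A" and \<phi>: "\<phi> \<in> F \<rightarrow>\<^sub>E B" using p by auto
  show "(case p of (\<psi>, \<phi>) \<Rightarrow> \<lambda>f. if f \<in> F then \<phi> f else \<psi> f) \<in> PiE E (\<lambda>f. if f \<in> F then B else A)"
    using assms PiE_mem[OF \<psi>] PiE_mem[OF \<phi>] PiE_arb[OF \<psi>] by auto
  show "(restrict (case p of (\<psi>, \<phi>) \<Rightarrow> \<lambda>f. if f \<in> F then \<phi> f else \<psi> f) (E - F),
      restrict (case p of (\<psi>, \<phi>) \<Rightarrow> \<lambda>f. if f \<in> F then \<phi> f else \<psi> f) F) = p"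
    using PiE_arb[OF \<psi>] PiE_arb[OF \<phi>] by (auto simp: fun_eq_iff)
qed

text \<open>
  The orientation may depend on \<open>F\<close>. The coefficient records the edges of \<open>F\<close> whose first leg lies at
  the head: they use the form \<open>- \<Sum> \<xi>\<^sub>i \<otimes> \<eta>\<^sub>i\<close> of the odd part, the other edges of \<open>F\<close> use
  \<open>\<Sum> \<eta>\<^sub>i \<otimes> \<xi>\<^sub>i\<close>.
\<close>

lemma twisted_element_power:
  assumes es: "distinct es"
  shows "tensor_prod_list (map (\<lambda>_. twisted_element k e l \<xi>) es) =
    (\<Sum>F\<in>Pow (set es). \<Sum>\<psi>\<in>(set es - F) \<rightarrow>\<^sub>E {1..k}. \<Sum>\<phi>\<in>F \<rightarrow>\<^sub>E {1..2 * l}.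
       prod_list (map (\<lambda>f. if s f = \<omega> F f then 1 else - 1) (filter (\<lambda>f. f \<in> F) es)) *\<^sub>C
       tensor_word (map (half_edge_vector e l \<xi> F (\<omega> F) \<psi> \<phi>) (legs_edge_order es s)))"
proof -
  let ?D0 = "\<Sum>i\<in>{1..k}. tensor_word [e i, e i]"
  let ?D1 = "- (\<Sum>i\<in>{1..2 * l}. tensor_word [\<xi> i, eta l \<xi> i])"
  have "twisted_element k e l \<xi> = ?D0 + ?D1" by (simp add: twisted_element_def)
  then have "tensor_prod_list (map (\<lambda>_. twisted_element k e l \<xi>) es) =
      (\<Sum>F\<in>Pow (set es). tensor_prod_list (map (\<lambda>f. if f \<in> F then ?D1 else ?D0) es))"
    using tensor_prod_list_add[OF es, of "\<lambda>_. ?D0" "\<lambda>_. ?D1"] by simp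
  also have "\<dots> = (\<Sum>F\<in>Pow (set es). \<Sum>\<psi>\<in>(set es - F) \<rightarrow>\<^sub>E {1..k}. \<Sum>\<phi>\<in>F \<rightarrow>\<^sub>E {1..2 * l}.
       prod_list (map (\<lambda>f. if s f = \<omega> F f then 1 else - 1) (filter (\<lambda>f. f \<in> F) es)) *\<^sub>C
       tensor_word (map (half_edge_vector e l \<xi> F (\<omega> F) \<psi> \<phi>) (legs_edge_order es s)))"
  proof (rule sum.cong[OF refl])
    fix F assume "F \<in> Pow (set es)"
    then have F: "F \<subseteq> set es" by simp
    let ?X = "half_edge_vector e l \<xi> F (\<omega> F)"
    let ?q = "\<lambda>f. if f \<in> F then (if s f = \<omega> F f then 1 else - 1) else 1 :: complex"
    let ?w = "\<lambda>c f. [?X c c (f, s f), ?X c c (f, \<not> s f)]"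
    \<comment> \<open>The summand of colour \<open>i\<close> at \<open>f\<close>, in the form of the odd part that fits the orientation.\<close>
    let ?T = "\<lambda>f i. ?q f *\<^sub>C tensor_word [?X (\<lambda>_. i) (\<lambda>_. i) (f, s f), ?X (\<lambda>_. i) (\<lambda>_. i) (f, \<not> s f)]"
    let ?I = "\<lambda>f. if f \<in> F then {1..2 * l} else {1..k}"
    have flip: "(\<Sum>i\<in>?I f. ?T f i) = (if f \<in> F then ?D1 else ?D0)" for f
      using twisted_element_odd_flip[of l \<xi>]
      by (auto simp: half_edge_vector_def sum_negf)
    have "tensor_prod_list (map (\<lambda>f. if f \<in> F then ?D1 else ?D0) es) =
        tensor_prod_list (map (\<lambda>f. \<Sum>i\<in>?I f. ?T f i) es)"
      by (simp only: flip)
    also have "\<dots> = (\<Sum>c\<in>PiE (set es) ?I. tensor_prod_list (map (\<lambda>f. ?T f (c f)) es))"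
      by (rule tensor_prod_list_sum[OF es])
    also have "\<dots> = (\<Sum>c\<in>PiE (set es) ?I. prod_list (map ?q es) *\<^sub>C tensor_word (map (?X c c) (legs_edge_order es s)))"
    proof (rule sum.cong[OF refl])
      fix c
      have "(\<lambda>f. ?T f (c f)) = (\<lambda>f. ?q f *\<^sub>C tensor_word (?w c f))"
        by (simp add: half_edge_vector_def)
      moreover have "concat (map (?w c) es) = map (?X c c) (legs_edge_order es s)"
        by (simp add: legs_edge_order_def map_concat o_def)
      ultimately show "tensor_prod_list (map (\<lambda>f. ?T f (c f)) es) =
          prod_list (map ?q es) *\<^sub>C tensor_word (map (?X c c) (legs_edge_order es s))"
        by (simp only: tensor_prod_list_words)
    qed
    also have "prod_list (map ?q es) = prod_list (map (\<lambda>f. if s f = \<omega> F f then 1 else - 1) (filter (\<lambda>f. f \<in> F) es))"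
      by (induction es) simp_all
    also have "(\<Sum>c\<in>PiE (set es) ?I. prod_list (map (\<lambda>f. if s f = \<omega> F f then 1 else - 1) (filter (\<lambda>f. f \<in> F) es)) *\<^sub>C
          tensor_word (map (?X c c) (legs_edge_order es s))) =
        (\<Sum>\<psi>\<in>(set es - F) \<rightarrow>\<^sub>E {1..k}. \<Sum>\<phi>\<in>F \<rightarrow>\<^sub>E {1..2 * l}.
          prod_list (map (\<lambda>f. if s f = \<omega> F f then 1 else - 1) (filter (\<lambda>f. f \<in> F) es)) *\<^sub>C
          tensor_word (map (?X \<psi> \<phi>) (legs_edge_order es s)))"
    proof -
      have "?X (\<lambda>f. if f \<in> F then \<phi> f else \<psi> f) (\<lambda>f. if f \<in> F then \<phi> f else \<psi> f) = ?X \<psi> \<phi>" for \<phi> \<psi>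
        by (auto simp: half_edge_vector_def)
      then show ?thesis by (simp only: sum_PiE_merge[OF F])
    qed
    finally show "tensor_prod_list (map (\<lambda>f. if f \<in> F then ?D1 else ?D0) es) =
        (\<Sum>\<psi>\<in>(set es - F) \<rightarrow>\<^sub>E {1..k}. \<Sum>\<phi>\<in>F \<rightarrow>\<^sub>E {1..2 * l}.
          prod_list (map (\<lambda>f. if s f = \<omega> F f then 1 else - 1) (filter (\<lambda>f. f \<in> F) es)) *\<^sub>C
          tensor_word (map (?X \<psi> \<phi>) (legs_edge_order es s)))" .
  qed
  finally show ?thesis .
qed


section \<open>Evaluating a tensor network on a word\<close>

lemma set_legs_edge_order: "set (legs_edge_order es s) = set es \<times> UNIV"
  by (auto simp: legs_edge_order_def)

lemma distinct_legs_edge_order: "distinct es \<Longrightarrow> distinct (legs_edge_order es s)"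
  unfolding legs_edge_order_def by (simp add: distinct_concat_map)

lemma set_legs_vertex_order:
  assumes "finite_multigraph G" "network_order G es vs hs"
  shows "set (legs_vertex_order vs hs) = edges G \<times> UNIV"
proof -
  have "set (legs_vertex_order vs hs) = (\<Union>v\<in>verts G. half_edges_at G (edges G) v)"
    using assms(2) by (auto simp: legs_vertex_order_def network_order_def)
  also have "\<dots> = edges G \<times> UNIV"
    using assms(1) by (auto simp: half_edges_at_def finite_multigraph_def)
  finally show ?thesis .
qed

lemma distinct_legs_vertex_order:
  assumes "network_order G es vs hs"
  shows "distinct (legs_vertex_order vs hs)"
proof -
  have vs: "distinct vs" using assms by (simp add: network_order_def)
  show ?thesis
    using assms unfolding legs_vertex_order_def distinct_concat_map[OF vs]
    by (auto simp: network_order_def half_edges_at_def)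
qed

lemma multilinear_vertex_functionals:
  fixes h :: "'a::super_vec super_sym \<Rightarrow> complex"
  assumes "clinear h"
  shows "multilinear (split_eval (map (\<lambda>v. (d v, h \<circ> \<varpi>)) vs))"
proof -
  have "clinear (h \<circ> \<varpi>)"
    using assms
    by (simp add: clinear_iff plus_super_sym.abs_eq[symmetric] scaleC_super_sym.abs_eq[symmetric])
  then show ?thesis by (intro multilinear_split_eval) auto
qed

lemma split_eval_concat:
  "split_eval (map (\<lambda>v. (length (w v), g)) vs) (concat (map w vs)) = prod_list (map (\<lambda>v. g (tensor_word (w v))) vs)"
  by (induction vs) simp_all

lemma clinear_network_functional:
  assumes h: "clinear h" and graph: "finite_multigraph G" and order: "network_order G es vs hs"
  shows "clinear (\<lambda>t. tensor_functional (map (\<lambda>v. (deg G v, h \<circ> \<varpi>)) vs) (regroup es s vs hs t))"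
proof -
  have F: "clinear (tensor_functional (map (\<lambda>v. (deg G v, h \<circ> \<varpi>)) vs))"
    unfolding tensor_functional_def by (rule clinear_tensor_lift[OF multilinear_vertex_functionals[OF h]])
  have "rearrangement (legs_edge_order es s) (legs_vertex_order vs hs) permutes {..<length (legs_edge_order es s)}"
    using order set_legs_vertex_order[OF graph order] distinct_legs_vertex_order[OF order]
    by (intro rearrangement_permutes) (simp_all add: distinct_legs_edge_order set_legs_edge_order network_order_def)
  from clinear_tensor_lift[OF multilinear_koszul_word[OF this]]
  have "clinear (regroup es s vs hs :: 'a tensor \<Rightarrow> 'a tensor)"
    unfolding regroup_def koszul_act_def .
  then show ?thesis using F by (simp add: clinear_iff)
qed

lemma network_functional_word:
  assumes h: "clinear h" and graph: "finite_multigraph G" and order: "network_order G es vs hs"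
    and X: "\<And>a. fst a \<in> edges G \<Longrightarrow> X a \<in> component (P a)"
  shows "tensor_functional (map (\<lambda>v. (deg G v, h \<circ> \<varpi>)) vs)
      (regroup es s vs hs (tensor_word (map X (legs_edge_order es s)))) =
    order_sign (filter P (legs_edge_order es s)) (filter P (legs_vertex_order vs hs)) *
    (\<Prod>v\<in>verts G. h (\<varpi> (tensor_word (map X (hs v)))))"
proof -
  let ?\<Phi> = "tensor_functional (map (\<lambda>v. (deg G v, h \<circ> \<varpi>)) vs)"
  note ml = multilinear_vertex_functionals[OF h, of "deg G" vs]
  have \<Phi>: "clinear ?\<Phi>" unfolding tensor_functional_def by (rule clinear_tensor_lift[OF ml])
  have vs: "distinct vs" "set vs = verts G" using order by (simp_all add: network_order_def)
  have LE: "distinct (legs_edge_order es s)" "set (legs_edge_order es s) = edges G \<times> UNIV"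
    using order by (simp_all add: distinct_legs_edge_order set_legs_edge_order network_order_def)
  have "regroup es s vs hs (tensor_word (map X (legs_edge_order es s))) =
      order_sign (filter P (legs_edge_order es s)) (filter P (legs_vertex_order vs hs)) *\<^sub>C
      tensor_word (map X (legs_vertex_order vs hs))"
    unfolding regroup_def
  proof (rule koszul_act_homogeneous[OF LE(1) distinct_legs_vertex_order[OF order]])
    show "set (legs_edge_order es s) = set (legs_vertex_order vs hs)"
      using LE(2) set_legs_vertex_order[OF graph order] by simp
    show "X a \<in> component (P a)" if "a \<in> set (legs_edge_order es s)" for a
      using X[of a] that LE(2) by auto
  qed
  moreover have "?\<Phi> (tensor_word (map X (legs_vertex_order vs hs))) =
      (\<Prod>v\<in>verts G. h (\<varpi> (tensor_word (map X (hs v)))))"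
  proof -
    have deg: "deg G v = length (map X (hs v))" if "v \<in> set vs" for v
      using order that vs distinct_card[of "hs v"] by (simp add: network_order_def deg_def)
    have "?\<Phi> (tensor_word (map X (legs_vertex_order vs hs))) =
        split_eval (map (\<lambda>v. (length (map X (hs v)), h \<circ> \<varpi>)) vs) (concat (map (\<lambda>v. map X (hs v)) vs))"
      unfolding tensor_functional_def tensor_lift_word[OF ml]
      using deg by (simp add: legs_vertex_order_def map_concat o_def cong: map_cong)
    also have "\<dots> = prod_list (map (\<lambda>v. (h \<circ> \<varpi>) (tensor_word (map X (hs v)))) vs)"
      by (rule split_eval_concat)
    also have "\<dots> = (\<Prod>v\<in>verts G. h (\<varpi> (tensor_word (map X (hs v)))))"
      unfolding vs(2)[symmetric] by (simp add: prod.distinct_set_conv_list[OF vs(1)])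
    finally show ?thesis .
  qed
  ultimately show ?thesis
    by (simp only: clinear_functional_scale[OF \<Phi>])
qed

text \<open>
  Reordering the legs at a vertex, evens first and then the odd ones in a prescribed order, brings
  the argument of \<open>h\<close> into the form \<open>x\<^sub>1 \<odot> \<dots> \<odot> x\<^sub>a \<otimes> y\<^sub>1 \<and> \<dots> \<and> y\<^sub>j\<close>.
\<close>

lemma vertex_functional:
  assumes h: "clinear h" and "distinct H" "distinct (A @ B)" "set H = set (A @ B)"
    and P: "\<And>a. a \<in> set A \<Longrightarrow> \<not> P a" "\<And>a. a \<in> set B \<Longrightarrow> P a"
    and X: "\<And>a. a \<in> set H \<Longrightarrow> X a \<in> component (P a)"
  shows "h (\<varpi> (tensor_word (map X H))) = order_sign (filter P H) B * h (sym_ext (map X A) (map X B))"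
proof -
  have "filter P A = []" "filter P B = B" using P by (auto simp: filter_empty_conv filter_id_conv)
  then have "\<varpi> (tensor_word (map X H)) = order_sign (filter P H) B *\<^sub>C \<varpi> (tensor_word (map X (A @ B)))"
    using super_sym_proj_rearrange[OF assms(2-4) X] by simp
  then show ?thesis by (simp add: clinear_functional_scale[OF h] sym_ext_def)
qed

lemma vertex_functional_odd:
  assumes h: "clinear h" "vanishes_odd h" and "distinct H" "odd (length (filter P H))"
    and X: "\<And>a. a \<in> set H \<Longrightarrow> X a \<in> component (P a)"
  shows "h (\<varpi> (tensor_word (map X H))) = 0"
proof -
  let ?A = "filter (\<lambda>a. \<not> P a) H" and ?B = "filter P H"
  have "h (\<varpi> (tensor_word (map X H))) = order_sign ?B ?B * h (sym_ext (map X ?A) (map X ?B))"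
    by (rule vertex_functional[OF h(1) assms(3) _ _ _ _ X]) (use assms(3) in auto)
  moreover have "h (sym_ext (map X ?A) (map X ?B)) = 0"
  proof -
    have "set (map X ?A) \<subseteq> component False" "set (map X ?B) \<subseteq> component True"
      using X by fastforce+
    then show ?thesis using h(2) assms(4) unfolding vanishes_odd_def by simp
  qed
  ultimately show ?thesis by simp
qed


section \<open>Comparing the two sums\<close>

text \<open>
  The three factors are the coefficient of the expansion, the Koszul sign of the regrouping and the
  signs of the reorderings at the vertices. The coefficient is itself the sign of reordering the two
  legs of each edge into tail and head. All factors then compose to the sign of passing from the word
  of tails and heads to the word of the local pairs, which counts circuits.
\<close>

lemma eulerian_sign:
  assumes graph: "finite_multigraph G" and order: "network_order G es vs hs"
    and F: "F \<subseteq> edges G" and pair: "local_pairing G F \<omega> \<kappa>"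
  defines "P \<equiv> \<lambda>a. fst a \<in> F"
    and "B \<equiv> \<lambda>v. concat (map (\<lambda>(a, b). [a, b]) (enum_list (\<kappa> v)))"
  shows "prod_list (map (\<lambda>f. if s f = \<omega> f then 1 else - 1) (filter (\<lambda>f. f \<in> F) es)) *
      (order_sign (filter P (legs_edge_order es s)) (filter P (legs_vertex_order vs hs)) *
       (\<Prod>v\<in>verts G. order_sign (filter P (hs v)) (B v))) = (-1) ^ circuit_count G F \<kappa>"
proof -
  let ?LE = "filter P (legs_edge_order es s)" and ?LV = "filter P (legs_vertex_order vs hs)"
  let ?fs = "filter (\<lambda>f. f \<in> F) es"
  let ?W = "concat (map (\<lambda>f. [(f, \<omega> f), (f, \<not> \<omega> f)]) ?fs)" and ?BV = "concat (map B vs)"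
  have fin: "finite F" using F graph finite_subset by (auto simp: finite_multigraph_def)
  have vs: "distinct vs" "set vs = verts G" and es: "distinct es" "set es = edges G"
    using order by (simp_all add: network_order_def)
  have ends: "ends G f t \<in> verts G" if "f \<in> F" for f t
    using graph F that by (auto simp: finite_multigraph_def)
  have fs: "distinct ?fs" "set ?fs = F" using es F by auto
  have LE: "?LE = concat (map (\<lambda>f. [(f, s f), (f, \<not> s f)]) ?fs)"
    unfolding legs_edge_order_def P_def by (induction es) simp_all
  have LV: "?LV = concat (map (\<lambda>v. filter P (hs v)) vs)"
    by (simp add: legs_vertex_order_def filter_concat o_def)
  have dW: "distinct ?W" unfolding distinct_concat_map[OF fs(1)] by auto
  have dLE: "distinct ?LE" and dLV: "distinct ?LV"
    using es(1) distinct_legs_vertex_order[OF order] by (simp_all add: distinct_legs_edge_order)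
  have sLE: "set ?LE = F \<times> UNIV" and sLV: "set ?LV = F \<times> UNIV"
    using F es(2) set_legs_vertex_order[OF graph order] by (auto simp: set_legs_edge_order P_def)
  have sW: "set ?W = F \<times> UNIV" using fs(2) by auto
  have sB: "set (B v) = set (filter P (hs v))" if "v \<in> set vs" for v
    unfolding B_def using pairing_list(4)[OF fin pair, of v] that vs order F
    by (auto simp: network_order_def half_edges_at_def P_def)
  \<comment> \<open>An edge whose legs come head first contributes a transposition.\<close>
  have "order_sign ?W ?LE = prod_list (map (\<lambda>f. order_sign [(f, \<omega> f), (f, \<not> \<omega> f)] [(f, s f), (f, \<not> s f)]) ?fs)"
    unfolding LE by (rule order_sign_concat[OF dW]) auto
  also have "(\<lambda>f. order_sign [(f, \<omega> f), (f, \<not> \<omega> f)] [(f, s f), (f, \<not> s f)]) = (\<lambda>f. if s f = \<omega> f then 1 else - 1)"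
    using order_sign_swap[of "[(f, \<omega> f)]" "[(f, \<not> \<omega> f)]" for f] by (auto simp: order_sign_refl)
  finally have W_LE: "prod_list (map (\<lambda>f. if s f = \<omega> f then 1 else - 1) ?fs) = order_sign ?W ?LE" by simp
  have "order_sign ?LV ?BV = prod_list (map (\<lambda>v. order_sign (filter P (hs v)) (B v)) vs)"
    unfolding LV by (rule order_sign_concat) (use dLV LV sB in auto)
  also have "\<dots> = (\<Prod>v\<in>verts G. order_sign (filter P (hs v)) (B v))"
    unfolding vs(2)[symmetric] by (simp add: prod.distinct_set_conv_list[OF vs(1)])
  finally have LV_BV: "(\<Prod>v\<in>verts G. order_sign (filter P (hs v)) (B v)) = order_sign ?LV ?BV" by simp
  have dBV: "distinct ?BV"
    unfolding distinct_concat_map[OF vs(1)]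
  proof (intro conjI ballI impI)
    fix v assume v: "v \<in> set vs"
    show "distinct (B v)" unfolding B_def using pairing_list(3)[OF fin pair] v vs by simp
    fix w assume w: "w \<in> set vs" "v \<noteq> w"
    show "set (B v) \<inter> set (B w) = {}"
      using w v vs pairing_list(4)[OF fin pair] by (auto simp: B_def half_edges_at_def)
  qed
  have sBV: "set ?BV = F \<times> UNIV" using sB sLV unfolding LV by simp
  have "order_sign ?W ?LE * order_sign ?LE ?LV = order_sign ?W ?LV"
    using dW dLE dLV sW sLE sLV by (intro order_sign_trans) simp_all
  moreover have "order_sign ?W ?LV * order_sign ?LV ?BV = order_sign ?W ?BV"
    using dW dLV dBV sW sLV sBV by (intro order_sign_trans) simp_all
  moreover have "order_sign ?W ?BV = (-1) ^ circuit_count G F \<kappa>"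
    unfolding B_def by (rule pairing_sign[OF fin ends vs pair fs])
  ultimately show ?thesis unfolding W_LE LV_BV by (simp add: mult.assoc[symmetric])
qed

lemma vertex_value_eq:
  assumes fin: "finite F" "finite A" and pair: "local_pairing G F \<omega> \<kappa>" and v: "v \<in> verts G"
    and A: "\<And>a. a \<in> A \<Longrightarrow> fst a \<notin> F"
  shows "vertex_value h e l \<xi> A (\<kappa> v) \<psi> \<phi> =
    h (sym_ext (map (half_edge_vector e l \<xi> F \<omega> \<psi> \<phi>) (enum_list A))
      (map (half_edge_vector e l \<xi> F \<omega> \<psi> \<phi>) (concat (map (\<lambda>(a, b). [a, b]) (enum_list (\<kappa> v))))))"
proof -
  let ?X = "half_edge_vector e l \<xi> F \<omega> \<psi> \<phi>"
  have "map ?X (enum_list A) = map (\<lambda>a. e (\<psi> (fst a))) (enum_list A)"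
    by (rule map_cong[OF refl]) (use enum_list[OF fin(2)] A in \<open>auto simp: half_edge_vector_def\<close>)
  moreover have "map (\<lambda>(a, b). [?X a, ?X b]) (enum_list (\<kappa> v)) =
      map (\<lambda>(a1, a2). [\<xi> (\<phi> (fst a1)), eta l \<xi> (\<phi> (fst a2))]) (enum_list (\<kappa> v))"
  proof (rule map_cong[OF refl])
    fix p assume "p \<in> set (enum_list (\<kappa> v))"
    then have p: "p \<in> \<kappa> v" using pairing_list(2)[OF fin(1) pair v] by simp
    have "fst p \<in> incoming G F \<omega> v" "snd p \<in> outgoing G F \<omega> v"
      using pair v p bij_betw_apply unfolding local_pairing_def by fastforce+
    then have "?X (fst p) = \<xi> (\<phi> (fst (fst p)))" "?X (snd p) = eta l \<xi> (\<phi> (fst (snd p)))"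
      by (auto simp: incoming_def outgoing_def half_edges_at_def half_edge_vector_def)
    then show "(case p of (a, b) \<Rightarrow> [?X a, ?X b]) = (case p of (a1, a2) \<Rightarrow> [\<xi> (\<phi> (fst a1)), eta l \<xi> (\<phi> (fst a2))])"
      by (simp add: case_prod_unfold)
  qed
  moreover have "map ?X (concat (map (\<lambda>(a, b). [a, b]) ps)) = concat (map (\<lambda>(a, b). [?X a, ?X b]) ps)" for ps
    by (induction ps) auto
  ultimately show ?thesis unfolding vertex_value_def by (simp only:)
qed

theorem theorem6p1:
  fixes b :: "'a::super_vec \<Rightarrow> 'a \<Rightarrow> complex"
    and e \<xi> :: "nat \<Rightarrow> 'a" and k l :: nat
    and h :: "'a super_sym \<Rightarrow> complex"
    and G :: "('v, 'e) multigraph"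
    and es :: "'e list" and s :: "'e \<Rightarrow> bool"
    and vs :: "'v list" and hs :: "'v \<Rightarrow> 'e half_edge list"
    and \<omega> :: "'e set \<Rightarrow> 'e \<Rightarrow> bool"
    and \<kappa> :: "'e set \<Rightarrow> 'v \<Rightarrow> ('e half_edge \<times> 'e half_edge) set"
  assumes finite_dim: "\<exists>B :: 'a set. finite B \<and> cvec.span B = UNIV"
    and form: "bilinear_form b" "nondegenerate_form b" "even_form b" "supersymmetric_form b"
    and coordinates: "adapted_coordinates b k e l \<xi>"
    and h: "clinear h" "vanishes_odd h"
    and graph: "finite_multigraph G"
    and order: "network_order G es vs hs"
    and orientation: "\<And>F. eulerian G F \<Longrightarrow> balanced_orientation G F (\<omega> F)"
    and pairing: "\<And>F. eulerian G F \<Longrightarrow> local_pairing G F (\<omega> F) (\<kappa> F)"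
  shows "tensor_network h (twisted_element k e l \<xi>) G es s vs hs = eulerian_sum h k e l \<xi> G \<kappa>"
proof -
  let ?\<Phi> = "\<lambda>t. tensor_functional (map (\<lambda>v. (deg G v, h \<circ> \<varpi>)) vs) (regroup es s vs hs t)"
  let ?X = "\<lambda>F. half_edge_vector e l \<xi> F (\<omega> F)"
  let ?q = "\<lambda>F. prod_list (map (\<lambda>f. if s f = \<omega> F f then 1 else - 1 :: complex) (filter (\<lambda>f. f \<in> F) es))"
  let ?P = "\<lambda>F a. fst a \<in> F"
  let ?S = "\<lambda>F. order_sign (filter (?P F) (legs_edge_order es s)) (filter (?P F) (legs_vertex_order vs hs))"
  let ?V = "\<lambda>F \<psi> \<phi> v. h (\<varpi> (tensor_word (map (?X F \<psi> \<phi>) (hs v))))"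
  let ?term = "\<lambda>F. \<Sum>\<psi>\<in>(edges G - F) \<rightarrow>\<^sub>E {1..k}. \<Sum>\<phi>\<in>F \<rightarrow>\<^sub>E {1..2 * l}. ?q F * (?S F * (\<Prod>v\<in>verts G. ?V F \<psi> \<phi> v))"
  have es: "distinct es" "set es = edges G" and fin: "finite (edges G)" "finite (verts G)"
    using order graph by (simp_all add: network_order_def finite_multigraph_def)
  have hs: "distinct (hs v)" "set (hs v) = half_edges_at G (edges G) v" if "v \<in> verts G" for v
    using order that by (simp_all add: network_order_def)
  note \<Phi> = clinear_network_functional[OF h(1) graph order]
  note comp = half_edge_vector_component[OF coordinates, where E = "edges G"]
  have fin_at: "finite (half_edges_at G F v)" if "F \<subseteq> edges G" for F v
    by (rule finite_subset[of _ "edges G \<times> UNIV"]) (use that fin in \<open>auto simp: half_edges_at_def\<close>)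
  have "tensor_network h (twisted_element k e l \<xi>) G es s vs hs = (\<Sum>F\<in>Pow (edges G). ?term F)"
    unfolding tensor_network_def twisted_element_power[OF es(1), where \<omega> = \<omega> and s = s] es(2)
      clinear_sum[OF \<Phi>] clinear_functional_scale[OF \<Phi>]
  proof (intro sum.cong refl)
    fix F \<psi> \<phi>
    assume *: "\<psi> \<in> (edges G - F) \<rightarrow>\<^sub>E {1..k}" "\<phi> \<in> F \<rightarrow>\<^sub>E {1..2 * l}"
    show "?q F * ?\<Phi> (tensor_word (map (?X F \<psi> \<phi>) (legs_edge_order es s))) =
        ?q F * (?S F * (\<Prod>v\<in>verts G. ?V F \<psi> \<phi> v))"
      by (subst network_functional_word[OF h(1) graph order, where P = "?P F"]) (use comp[OF *] in auto)
  qed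
  also have "\<dots> = (\<Sum>F | eulerian G F. ?term F)"
  proof (rule sum.mono_neutral_right)
    show "finite (Pow (edges G))" using fin by simp
    show "{F. eulerian G F} \<subseteq> Pow (edges G)" by (auto simp: eulerian_def)
    show "\<forall>F\<in>Pow (edges G) - {F. eulerian G F}. ?term F = 0"
    proof
      fix F assume "F \<in> Pow (edges G) - {F. eulerian G F}"
      then obtain v where F: "F \<subseteq> edges G" and v: "v \<in> verts G" "odd (card (half_edges_at G F v))"
        by (auto simp: eulerian_def)
      \<comment> \<open>The word at \<open>v\<close> has odd exterior degree.\<close>
      have "set (filter (?P F) (hs v)) = half_edges_at G F v"
        using hs(2)[OF v(1)] F by (auto simp: half_edges_at_def)
      then have len: "odd (length (filter (?P F) (hs v)))"
        using v(2) hs(1)[OF v(1)] by (metis distinct_card distinct_filter)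
      show "?term F = 0"
      proof (intro sum.neutral ballI)
        fix \<psi> \<phi> assume *: "\<psi> \<in> (edges G - F) \<rightarrow>\<^sub>E {1..k}" "\<phi> \<in> F \<rightarrow>\<^sub>E {1..2 * l}"
        have "?V F \<psi> \<phi> v = 0"
          by (rule vertex_functional_odd[OF h hs(1)[OF v(1)] len])
            (use comp[OF *] hs(2)[OF v(1)] in \<open>auto simp: half_edges_at_def\<close>)
        then have "(\<Prod>v\<in>verts G. ?V F \<psi> \<phi> v) = 0" using v(1) fin(2) by (auto intro: prod_zero)
        then show "?q F * (?S F * (\<Prod>v\<in>verts G. ?V F \<psi> \<phi> v)) = 0" by simp
      qed
    qed
  qed
  also have "\<dots> = eulerian_sum h k e l \<xi> G \<kappa>"
    unfolding eulerian_sum_def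
  proof (rule sum.cong[OF refl])
    fix F assume "F \<in> {F. eulerian G F}"
    then have F: "F \<subseteq> edges G" and pair: "local_pairing G F (\<omega> F) (\<kappa> F)"
      using pairing by (auto simp: eulerian_def)
    have finF: "finite F" using F fin finite_subset by blast
    let ?A = "\<lambda>v. half_edges_at G (edges G - F) v"
    let ?B = "\<lambda>v. concat (map (\<lambda>(a, b). [a, b]) (enum_list (\<kappa> F v)))"
    have vertex: "?V F \<psi> \<phi> v = order_sign (filter (?P F) (hs v)) (?B v) * vertex_value h e l \<xi> (?A v) (\<kappa> F v) \<psi> \<phi>"
      if *: "\<psi> \<in> (edges G - F) \<rightarrow>\<^sub>E {1..k}" "\<phi> \<in> F \<rightarrow>\<^sub>E {1..2 * l}" and v: "v \<in> verts G" for \<psi> \<phi> v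
    proof -
      have A: "distinct (enum_list (?A v))" "set (enum_list (?A v)) = ?A v"
        using enum_list[OF fin_at[of "edges G - F" v]] by auto
      note B = pairing_list(3,4)[OF finF pair v]
      have "?V F \<psi> \<phi> v = order_sign (filter (?P F) (hs v)) (?B v) *
          h (sym_ext (map (?X F \<psi> \<phi>) (enum_list (?A v))) (map (?X F \<psi> \<phi>) (?B v)))"
      proof (rule vertex_functional[OF h(1) hs(1)[OF v]])
        show "distinct (enum_list (?A v) @ ?B v)"
          unfolding distinct_append A(2) B(2) using A(1) B(1) by (auto simp: half_edges_at_def)
        show "set (hs v) = set (enum_list (?A v) @ ?B v)"
          unfolding set_append A(2) B(2) hs(2)[OF v] using F by (auto simp: half_edges_at_def)
        show "\<not> ?P F a" if "a \<in> set (enum_list (?A v))" for a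
          using that unfolding A(2) by (auto simp: half_edges_at_def)
        show "?P F a" if "a \<in> set (?B v)" for a
          using that unfolding B(2) by (auto simp: half_edges_at_def)
        show "?X F \<psi> \<phi> a \<in> component (?P F a)" if "a \<in> set (hs v)" for a
          by (rule comp[OF *]) (use that hs(2)[OF v] in \<open>auto simp: half_edges_at_def\<close>)
      qed
      also have "h (sym_ext (map (?X F \<psi> \<phi>) (enum_list (?A v))) (map (?X F \<psi> \<phi>) (?B v))) =
          vertex_value h e l \<xi> (?A v) (\<kappa> F v) \<psi> \<phi>"
        by (rule vertex_value_eq[OF finF fin_at pair v, symmetric]) (auto simp: half_edges_at_def)
      finally show ?thesis .
    qed
    show "?term F = (-1) ^ circuit_count G F (\<kappa> F) *
        (\<Sum>\<psi> \<in> (edges G - F) \<rightarrow>\<^sub>E {1..k}. \<Sum>\<phi> \<in> F \<rightarrow>\<^sub>E {1..2 * l}.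
           \<Prod>v\<in>verts G. vertex_value h e l \<xi> (?A v) (\<kappa> F v) \<psi> \<phi>)"
      unfolding sum_distrib_left
    proof (intro sum.cong refl)
      fix \<psi> \<phi> assume *: "\<psi> \<in> (edges G - F) \<rightarrow>\<^sub>E {1..k}" "\<phi> \<in> F \<rightarrow>\<^sub>E {1..2 * l}"
      have "(\<Prod>v\<in>verts G. ?V F \<psi> \<phi> v) = (\<Prod>v\<in>verts G. order_sign (filter (?P F) (hs v)) (?B v)) *
          (\<Prod>v\<in>verts G. vertex_value h e l \<xi> (?A v) (\<kappa> F v) \<psi> \<phi>)"
        unfolding prod.distrib[symmetric] by (rule prod.cong[OF refl]) (rule vertex[OF *])
      then have "?q F * (?S F * (\<Prod>v\<in>verts G. ?V F \<psi> \<phi> v)) =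
          (?q F * (?S F * (\<Prod>v\<in>verts G. order_sign (filter (?P F) (hs v)) (?B v)))) *
          (\<Prod>v\<in>verts G. vertex_value h e l \<xi> (?A v) (\<kappa> F v) \<psi> \<phi>)"
        by (simp only: mult.assoc)
      also have "?q F * (?S F * (\<Prod>v\<in>verts G. order_sign (filter (?P F) (hs v)) (?B v))) =
          (-1) ^ circuit_count G F (\<kappa> F)"
        by (rule eulerian_sign[OF graph order F pair])
      finally show "?q F * (?S F * (\<Prod>v\<in>verts G. ?V F \<psi> \<phi> v)) = (-1) ^ circuit_count G F (\<kappa> F) *
          (\<Prod>v\<in>verts G. vertex_value h e l \<xi> (?A v) (\<kappa> F v) \<psi> \<phi>)" .
    qed
  qed
  finally show ?thesis .
qed

end
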